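(* Let $n\ge 2$. An operation $*\colon\mathcal{C}\to\mathcal{K}^p(\mathbb{S}^n)$ is non-trivial and projection covariant if and only if either $K*L=\mathrm{conv}(K\cup L)$ for all $(K,L)\in\mathcal{C}$, or $K*L=-\mathrm{conv}(K\cup L)$ for all $(K,L)\in\mathcal{C}$.
   Context: $\mathbb{S}^n$ is the Euclidean unit sphere in $\mathbb{R}^{n+1}$. A set $A\subseteq\mathbb{S}^n$ is (spherically) convex if $\mathrm{rad}\,A=\{\lambda x:\lambda\ge0,\ x\in A\}\subseteq\mathbb{R}^{n+1}$ is convex. A convex body is a nonempty closed convex subset of $\mathbb{S}^n$; it is proper if contained in an open hemisphere. $\mathcal{K}^p(\mathbb{S}^n)$ is the set of proper convex bodies, and for $u\in\mathbb{S}^n$, $\mathcal{K}^p_u(\mathbb{S}^n)$ is the set of convex bodies contained in the open hemisphere $\{v\in\mathbb{S}^n:u\cdot v>0\}$. Put $\mathcal{C}=\bigcup_{u\in\mathbb{S}^n}\left(\mathcal{K}^p_u(\mathbb{S}^n)\times\mathcal{K}^p_u(\mathbb{S}^n)\right)$, the set of all pairs $(K,L)$ such that $K$ and $L$ are contained in a common open hemisphere. The convex hull $\mathrm{conv}(A)$ of $A\subseteq\mathbb{S}^n$ is the intersection of all convex subsets of $\mathbb{S}^n$ containing $A$; $-A=\{-x:x\in A\}$. For $0\le k\le n$, a $k$-sphere is $S=V\cap\mathbb{S}^n$ with $V\subseteq\mathbb{R}^{n+1}$ a $(k+1)$-dimensional linear subspace. The spherical projection is $K|S=\mathrm{conv}(K\cup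 S^\circ)\cap S=(\mathrm{rad}(K)|V)\cap\mathbb{S}^n$, where $S^\circ=V^\perp\cap\mathbb{S}^n$ and $\mathrm{rad}(K)|V$ is the orthogonal projection onto $V$. The operation $*$ is projection covariant if for every $u\in\mathbb{S}^n$, every $k$-sphere $S$, $0\le k\le n-1$, with $u\in S$, and all $K,L\in\mathcal{K}^p_u(\mathbb{S}^n)$, one has $(K|S)*(L|S)=(K*L)|S$. The operation $*$ on $\mathcal{C}$ is trivial if one of the following holds: $K*L=K$ for all $(K,L)\in\mathcal{C}$; $K*L=-K$ for all $(K,L)\in\mathcal{C}$; $K*L=L$ for all $(K,L)\in\mathcal{C}$; $K*L=-L$ for all $(K,L)\in\mathcal{C}$. Otherwise it is non-trivial. *)

theory Defs
  imports "HOL-Analysis.Analysis"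
begin

text \<open>The unit sphere of an \<open>(n+1)\<close>-dimensional Euclidean space is \<^term>\<open>sphere 0 1\<close>; subsets of it
  are represented as subsets of the ambient space.\<close>

definition rad :: "'a::euclidean_space set \<Rightarrow> 'a set" where
  "rad A = {l *\<^sub>R x | l x. 0 \<le> l \<and> x \<in> A}"

definition spherical_convex :: "'a::euclidean_space set \<Rightarrow> bool" where
  "spherical_convex A \<longleftrightarrow> A \<subseteq> sphere 0 1 \<and> convex (rad A)"

text \<open>For \<^prop>\<open>A \<subseteq> sphere 0 1\<close>, \<^term>\<open>spherical_convex hull A\<close> is the intersection of all convex
  subsets of the sphere containing \<^term>\<open>A\<close>.\<close>

abbreviation sconv :: "'a::euclidean_space set \<Rightarrow> 'a set" where
  "sconv A \<equiv> spherical_convex hull A"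

definition convex_body :: "'a::euclidean_space set \<Rightarrow> bool" where
  "convex_body K \<longleftrightarrow> K \<noteq> {} \<and> closed K \<and> spherical_convex K"

definition open_hemisphere :: "'a::euclidean_space \<Rightarrow> 'a set" where
  "open_hemisphere u = {v \<in> sphere 0 1. u \<bullet> v > 0}"

definition bodies_in :: "'a::euclidean_space \<Rightarrow> 'a set set" where
  "bodies_in u = {K. convex_body K \<and> K \<subseteq> open_hemisphere u}"

definition proper_bodies :: "'a::euclidean_space set set" where
  "proper_bodies = {K. convex_body K \<and> (\<exists>u \<in> sphere 0 1. K \<subseteq> open_hemisphere u)}"

definition body_pairs :: "('a::euclidean_space set \<times> 'a set) set" where
  "body_pairs = (\<Union>u \<in> sphere 0 1. bodies_in u \<times> bodies_in u)"

definition k_sphere :: "nat \<Rightarrow> 'a::euclidean_space set \<Rightarrow> bool" where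
  "k_sphere k S \<longleftrightarrow> (\<exists>V. subspace V \<and> dim V = k + 1 \<and> S = V \<inter> sphere 0 1)"

text \<open>If \<^term>\<open>S = V \<inter> sphere 0 1\<close> for a subspace \<^term>\<open>V\<close>, then \<^term>\<open>span S = V\<close>.\<close>

definition sphere_complement :: "'a::euclidean_space set \<Rightarrow> 'a set" where
  "sphere_complement S = (span S)\<^sup>\<bottom> \<inter> sphere 0 1"

definition sphere_proj :: "'a::euclidean_space set \<Rightarrow> 'a set \<Rightarrow> 'a set" where
  "sphere_proj K S = sconv (K \<union> sphere_complement S) \<inter> S"

text \<open>An operation is a function on all pairs of sets; only its values on \<^term>\<open>body_pairs\<close> matter.
  The bound \<open>k + 2 \<le> DIM('a)\<close> is \<open>k \<le> n - 1\<close>, where \<open>DIM('a) = n + 1\<close>.\<close>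

definition projection_covariant ::
    "('a::euclidean_space set \<Rightarrow> 'a set \<Rightarrow> 'a set) \<Rightarrow> bool" where
  "projection_covariant f \<longleftrightarrow>
     (\<forall>u \<in> sphere 0 1. \<forall>k S. k + 2 \<le> DIM('a) \<and> k_sphere k S \<and> u \<in> S \<longrightarrow>
        (\<forall>K \<in> bodies_in u. \<forall>L \<in> bodies_in u.
           f (sphere_proj K S) (sphere_proj L S) = sphere_proj (f K L) S))"

definition trivial_operation ::
    "('a::euclidean_space set \<Rightarrow> 'a set \<Rightarrow> 'a set) \<Rightarrow> bool" where
  "trivial_operation f \<longleftrightarrow>
     (\<forall>(K, L) \<in> body_pairs. f K L = K) \<or>
     (\<forall>(K, L) \<in> body_pairs. f K L = uminus ` K) \<or>
     (\<forall>(K, L) \<in> body_pairs. f K L = L) \<or>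
     (\<forall>(K, L) \<in> body_pairs. f K L = uminus ` L)"

lemma radI: "0 \<le> l \<Longrightarrow> x \<in> A \<Longrightarrow> l *\<^sub>R x \<in> rad A"
  unfolding rad_def by blast

lemma span_subspace_Int_sphere:
  fixes V :: "'a::euclidean_space set"
  assumes "subspace V"
  shows "span (V \<inter> sphere 0 1) = V"
proof
  show "span (V \<inter> sphere 0 1) \<subseteq> V"
    using assms by (intro span_minimal) auto
  show "V \<subseteq> span (V \<inter> sphere 0 1)"
  proof
    fix x assume x: "x \<in> V"
    show "x \<in> span (V \<inter> sphere 0 1)"
    proof (cases "x = 0")
      case True
      then show ?thesis by (simp add: span_zero)
    next
      case False
      have "x /\<^sub>R norm x \<in> V \<inter> sphere 0 1"
        using False x assms by (auto simp: subspace_scale)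
      then have "norm x *\<^sub>R (x /\<^sub>R norm x) \<in> span (V \<inter> sphere 0 1)"
        by (intro span_scale span_base)
      then show ?thesis using False by simp
    qed
  qed
qed

lemma closest_point_subspace_orthogonal:
  fixes V :: "'a::euclidean_space set"
  assumes V: "subspace V" and v: "v \<in> V"
  shows "(r - closest_point V r) \<bullet> v = 0"
proof -
  let ?p = "closest_point V r"
  have cl: "closed V" and cv: "convex V" and ne: "V \<noteq> {}"
    using V subspace_0[OF V] by (auto simp: closed_subspace subspace_imp_convex)
  have p: "?p \<in> V" using closest_point_in_set[OF cl ne] .
  have "(r - ?p) \<bullet> ((?p + v) - ?p) \<le> 0" "(r - ?p) \<bullet> ((?p - v) - ?p) \<le> 0"
    using closest_point_dot[OF cv cl] V p v by (blast intro: subspace_add subspace_diff)+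
  then show ?thesis by (simp add: inner_diff_right)
qed

lemma closest_point_subspace_eqI:
  fixes V :: "'a::euclidean_space set"
  assumes V: "subspace V" and x: "x \<in> V" and o: "\<And>v. v \<in> V \<Longrightarrow> (r - x) \<bullet> v = 0"
  shows "closest_point V r = x"
proof -
  let ?p = "closest_point V r"
  have "?p \<in> V"
    using V subspace_0[OF V] by (intro closest_point_in_set) (auto simp: closed_subspace)
  then have d: "x - ?p \<in> V" using V x by (simp add: subspace_diff)
  have "(x - ?p) \<bullet> (x - ?p) = 0"
    using closest_point_subspace_orthogonal[OF V d, of r] o[OF d] by (simp add: algebra_simps)
  then show ?thesis by simp
qed

text \<open>Spherical projection in terms of the orthogonal projection \<^term>\<open>closest_point V\<close>.\<close>

lemma sphere_proj_eq_orthogonal_projection: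
  fixes V :: "'a::euclidean_space set"
  assumes V: "subspace V" and K: "spherical_convex K"
  shows "sphere_proj K (V \<inter> sphere 0 1) = closest_point V ` rad K \<inter> sphere 0 1"
proof -
  let ?W = "V\<^sup>\<bottom>"
  let ?S = "V \<inter> sphere 0 1"
  let ?U = "K \<union> (?W \<inter> sphere 0 1)"
  have sW: "subspace ?W" by (rule subspace_orthogonal_comp)
  have SP: "sphere_proj K ?S = sconv ?U \<inter> ?S"
    by (simp add: sphere_proj_def sphere_complement_def span_subspace_Int_sphere[OF V])
  have clV: "closed V" and neV: "V \<noteq> {}" using V subspace_0[OF V] by (auto simp: closed_subspace)
  have K1: "K \<subseteq> sphere 0 1" and cK: "convex (rad K)" using K by (auto simp: spherical_convex_def)
  show ?thesis
  proof (intro equalityI subsetI)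
    fix x assume "x \<in> sphere_proj K ?S"
    then have xh: "x \<in> sconv ?U" and xV: "x \<in> V" and x1: "norm x = 1" by (auto simp: SP)
    show "x \<in> closest_point V ` rad K \<inter> sphere 0 1"
    proof (cases "K = {}")
      case True
      have r: "rad (?W \<inter> sphere 0 1) \<subseteq> ?W" using sW by (auto simp: rad_def subspace_scale)
      have "convex (rad (?W \<inter> sphere 0 1))"
      proof (cases "?W \<inter> sphere 0 1 = {}")
        case True
        then show ?thesis by (simp add: rad_def)
      next
        case False
        then obtain a where a: "a \<in> ?W \<inter> sphere 0 1" by blast
        have "w \<in> rad (?W \<inter> sphere 0 1)" if "w \<in> ?W" for w
        proof (cases "w = 0")
          case True
          then show ?thesis using a by (force simp: rad_def)
        next
          case False
          then have "w /\<^sub>R norm w \<in> ?W \<inter> sphere 0 1" "w = norm w *\<^sub>R (w /\<^sub>R norm w)"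
            using that sW by (auto simp: subspace_scale)
          then show ?thesis unfolding rad_def by (metis (mono_tags, lifting) mem_Collect_eq norm_ge_zero)
        qed
        then have "rad (?W \<inter> sphere 0 1) = ?W" using r by blast
        then show ?thesis using subspace_imp_convex[OF sW] by simp
      qed
      then have "spherical_convex (?W \<inter> sphere 0 1)" by (simp add: spherical_convex_def)
      then have "x \<in> ?W" using xh True by (auto simp: hull_def)
      then have "x \<bullet> x = 0" using xV by (auto simp: orthogonal_comp_def orthogonal_def)
      then show ?thesis using x1 by simp
    next
      case False
      let ?C = "{r + w | r w. r \<in> rad K \<and> w \<in> ?W}"
      have scal: "l *\<^sub>R y \<in> ?C" if "y \<in> ?C" "0 \<le> l" for l y
      proof -
        obtain m k w where "y = m *\<^sub>R k + w" "0 \<le> m" "k \<in> K" "w \<in> ?W"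
          using \<open>y \<in> ?C\<close> by (auto simp: rad_def)
        then have "l *\<^sub>R y = (l * m) *\<^sub>R k + l *\<^sub>R w" "0 \<le> l * m" "l *\<^sub>R w \<in> ?W"
          using \<open>0 \<le> l\<close> sW by (auto simp: algebra_simps subspace_scale)
        moreover have "(l * m) *\<^sub>R k \<in> rad K"
          using \<open>0 \<le> l * m\<close> \<open>k \<in> K\<close> unfolding rad_def by blast
        ultimately show ?thesis by blast
      qed
      have cC: "convex ?C"
      proof -
        have "?C = (\<Union>x\<in>rad K. \<Union>y\<in>?W. {x + y})" by blast
        then show ?thesis using convex_sums[OF cK subspace_imp_convex[OF sW]] by simp
      qed
      have r0: "0 \<in> rad K" using False by (force simp: rad_def)
      have KC: "K \<subseteq> ?C"
      proof
        fix k assume k: "k \<in> K"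
        have "k = 1 *\<^sub>R k + 0" "1 *\<^sub>R k \<in> rad K" "0 \<in> ?W"
          using k sW unfolding rad_def by (auto simp: subspace_0 intro!: exI[of _ 1])
        then show "k \<in> ?C" by blast
      qed
      have UC: "?U \<subseteq> ?C \<inter> sphere 0 1"
        using KC K1 r0 by force
      have "rad (?C \<inter> sphere 0 1) = ?C"
      proof (intro equalityI subsetI)
        fix y assume "y \<in> rad (?C \<inter> sphere 0 1)"
        then obtain l z where "y = l *\<^sub>R z" "0 \<le> l" "z \<in> ?C" unfolding rad_def by blast
        then show "y \<in> ?C" using scal by blast
      next
        fix y assume y: "y \<in> ?C"
        show "y \<in> rad (?C \<inter> sphere 0 1)"
        proof (cases "y = 0")
          case True
          obtain k where "k \<in> ?C \<inter> sphere 0 1" using UC \<open>K \<noteq> {}\<close> by blast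
          then show ?thesis unfolding rad_def using True
            by (smt (verit, best) mem_Collect_eq scaleR_zero_left)
        next
          case False
          have "y /\<^sub>R norm y \<in> ?C" by (rule scal[OF y]) simp
          moreover have "y /\<^sub>R norm y \<in> sphere 0 1" using False by simp
          moreover have "y = norm y *\<^sub>R (y /\<^sub>R norm y)" using False by simp
          ultimately show ?thesis unfolding rad_def
            by (metis (mono_tags, lifting) IntI mem_Collect_eq norm_ge_zero)
        qed
      qed
      then have "spherical_convex (?C \<inter> sphere 0 1)" using cC by (simp add: spherical_convex_def)
      then have "sconv ?U \<subseteq> ?C \<inter> sphere 0 1" using UC by (rule hull_minimal[rotated])
      then obtain r w where r: "x = r + w" "r \<in> rad K" "w \<in> ?W" using xh by blast
      have "closest_point V r = x"
      proof (rule closest_point_subspace_eqI[OF V xV])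
        fix v assume "v \<in> V"
        then show "(r - x) \<bullet> v = 0"
          using r by (simp add: orthogonal_comp_def orthogonal_def inner_commute)
      qed
      then show ?thesis using r(2) x1 by auto
    qed
  next
    fix x assume "x \<in> closest_point V ` rad K \<inter> sphere 0 1"
    then obtain r where r: "r \<in> rad K" "x = closest_point V r" and x1: "norm x = 1" by auto
    have xV: "x \<in> V" using closest_point_in_set[OF clV neV] r by simp
    have w: "x - r \<in> ?W"
      using closest_point_subspace_orthogonal[OF V, of _ r] r(2)
      by (auto simp: orthogonal_comp_def orthogonal_def inner_commute inner_diff_left inner_diff_right)
    obtain l k where l: "r = l *\<^sub>R k" "0 \<le> l" "k \<in> K" using r(1) by (auto simp: rad_def)
    have "x \<in> B" if B: "spherical_convex B" and UB: "?U \<subseteq> B" for B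
    proof -
      have c: "convex (rad B)" and B1: "B \<subseteq> sphere 0 1" using B by (auto simp: spherical_convex_def)
      have "(2 * l) *\<^sub>R k \<in> rad B" using l UB by (intro radI) auto
      moreover have "2 *\<^sub>R (x - r) \<in> rad B"
      proof (cases "x - r = 0")
        case True
        then show ?thesis using l UB unfolding rad_def
          by (smt (verit) UnCI mem_Collect_eq scaleR_zero_left scaleR_zero_right subsetD)
      next
        case False
        let ?y = "(x - r) /\<^sub>R norm (x - r)"
        have "?y \<in> ?W" using w sW by (rule subspace_scale[rotated])
        moreover have "norm ?y = 1" using False by simp
        ultimately have "?y \<in> B" using UB by auto
        moreover have "2 *\<^sub>R (x - r) = (2 * norm (x - r)) *\<^sub>R ?y" using False by simp
        ultimately show ?thesis unfolding rad_def
          by (metis (mono_tags, lifting) mem_Collect_eq mult_nonneg_nonneg norm_ge_zero zero_le_numeral)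
      qed
      ultimately have "(1/2) *\<^sub>R ((2 * l) *\<^sub>R k) + (1/2) *\<^sub>R (2 *\<^sub>R (x - r)) \<in> rad B"
        using c by (intro convexD) auto
      then have "x \<in> rad B" using l by simp
      then obtain m b where m: "x = m *\<^sub>R b" "0 \<le> m" "b \<in> B" by (auto simp: rad_def)
      then have "m = 1" using x1 B1 by auto
      then show "x \<in> B" using m by simp
    qed
    then have "x \<in> sconv ?U" by (auto simp: hull_def)
    then show "x \<in> sphere_proj K ?S" using xV x1 by (simp add: SP)
  qed
qed

end

theory Submission
  imports Defs
begin

text \<open>Write \<open>K\<close> and \<open>L\<close>, bodies in the open hemisphere with pole \<open>u\<close>, through their sets of slopes
  \<open>(y \<bullet> k) / (u \<bullet> k)\<close>, that is, their gnomonic shadows on lines. Covariance under projections to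
  \<open>0\<close>-spheres produces a global sign \<open>s\<close> such that \<open>s (K * L)\<close> lies in every open hemisphere
  containing \<open>K\<close> and \<open>L\<close>; covariance under projections to great circles makes the slopes of
  \<open>K * L\<close> a function \<open>\<Phi>\<close> of the slopes of \<open>K\<close> and \<open>L\<close>. Bodies lying on one great circle show that
  \<open>\<Phi>\<close> depends on neither \<open>u\<close> nor \<open>y\<close>, so \<open>\<Phi>\<close> commutes with all admissible projective maps of the
  line. Invariance under the maps fixing \<open>0\<close> and \<open>1\<close> forces \<open>\<Phi> {0} {1}\<close> to be \<open>{0}\<close>, \<open>{1}\<close> or
  \<open>{0..1}\<close>. A segment on the antidiagonal projects to a point in the diagonal direction, which puts
  the midpoint of an interval into its image under \<open>\<Phi>\<close>, and projective maps then push that midpoint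
  to an endpoint. Hence \<open>\<Phi>\<close> is the first or second argument or the hull of the union.\<close>

subsection \<open>Slopes of spherical convex bodies\<close>

text \<open>Rescaling \<open>k\<close> does not change the quotient, so slopes may be computed
  before points are normalised to the sphere.\<close>

definition slopes :: "'a::euclidean_space \<Rightarrow> 'a \<Rightarrow> 'a set \<Rightarrow> real set" where
  "slopes u y K = (\<lambda>k. (y \<bullet> k) / (u \<bullet> k)) ` K"

text \<open>The endpoints need not be unit vectors: taking them in the hyperplane
  \<open>u \<bullet> x = 1\<close> makes slopes linear along the segment.\<close>

definition arc :: "'a::euclidean_space \<Rightarrow> 'a \<Rightarrow> 'a set" where
  "arc p q = sgn ` closed_segment p q"

lemma rad_eq_conic_hull: "rad A = conic hull A"
  by (simp add: rad_def conic_hull_explicit)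

lemma inner_sgn_pos_iff: "u \<bullet> sgn x > 0 \<longleftrightarrow> u \<bullet> x > 0" for u x :: "'a::euclidean_space"
  by (cases "x = 0") (auto simp: sgn_div_norm zero_less_mult_iff)

lemma bodies_inD:
  assumes "K \<in> bodies_in u"
  shows "K \<noteq> {}" "compact K" "convex (rad K)" "spherical_convex K" "K \<subseteq> sphere 0 1"
    "\<And>k. k \<in> K \<Longrightarrow> u \<bullet> k > 0" "\<And>k. k \<in> K \<Longrightarrow> norm k = 1"
proof -
  show "compact K"
    using assms compact_Int_closed[OF compact_sphere, of K 0 1]
    by (auto simp: bodies_in_def convex_body_def spherical_convex_def Int_absorb1)
qed (use assms in \<open>auto simp: bodies_in_def convex_body_def spherical_convex_def open_hemisphere_def\<close>)

lemma bodies_inI: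
  assumes "convex_body K" "\<And>k. k \<in> K \<Longrightarrow> u \<bullet> k > 0"
  shows "K \<in> bodies_in u"
  using assms by (auto simp: bodies_in_def convex_body_def spherical_convex_def open_hemisphere_def)

lemma bodies_in_convex_body: "K \<in> bodies_in u \<Longrightarrow> convex_body K"
  by (simp add: bodies_in_def)

lemma bodies_in_change:
  assumes "K \<in> bodies_in u" "\<And>k. k \<in> K \<Longrightarrow> v \<bullet> k > 0"
  shows "K \<in> bodies_in v"
  using assms bodies_inI bodies_in_convex_body by blast

lemma bodies_in_sgn: "bodies_in (sgn u) = bodies_in u" for u :: "'a::euclidean_space"
proof -
  have "sgn u \<bullet> v > 0 \<longleftrightarrow> u \<bullet> v > 0" for v
    using inner_sgn_pos_iff[of v u] by (simp add: inner_commute)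
  then show ?thesis by (simp add: bodies_in_def open_hemisphere_def)
qed

section \<open>Radial projection and spherical convex hulls\<close>

lemma rad_sgn_image:
  fixes X :: "'a::euclidean_space set"
  shows "rad (sgn ` X) = rad X"
proof (intro equalityI subsetI)
  fix z assume "z \<in> rad (sgn ` X)"
  then obtain l x where "z = l *\<^sub>R sgn x" "0 \<le> l" "x \<in> X" by (auto simp: rad_def)
  then show "z \<in> rad X" by (auto simp: sgn_div_norm intro!: radI)
next
  fix z assume "z \<in> rad X"
  then obtain l x where z: "z = l *\<^sub>R x" "0 \<le> l" "x \<in> X" by (auto simp: rad_def)
  then have "z = (l * norm x) *\<^sub>R sgn x" by (cases "x = 0") (auto simp: sgn_div_norm)
  then show "z \<in> rad (sgn ` X)" using z by (auto intro!: radI)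
qed

text \<open>\<open>sgn\<close> leaves the cone unchanged, so spherical convexity comes from the
  conic hull of \<open>X\<close>; positivity keeps \<open>X\<close> away from \<open>0\<close>,
  where \<open>sgn\<close> is discontinuous.\<close>

lemma sgn_image_bodies_in:
  assumes "compact X" "convex X" "X \<noteq> {}" and pos: "\<And>x. x \<in> X \<Longrightarrow> u \<bullet> x > 0"
  shows "sgn ` X \<in> bodies_in u"
proof -
  have nz: "\<forall>x\<in>X. x \<noteq> 0" using pos by force
  then have "continuous_on X sgn"
    unfolding sgn_div_norm by (intro continuous_intros) auto
  then have "closed (sgn ` X)" using assms(1) compact_continuous_image compact_imp_closed by blast
  moreover have "convex (rad (sgn ` X))"
    using convex_conic_hull[OF assms(2)] by (metis rad_sgn_image rad_eq_conic_hull)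
  moreover have "sgn ` X \<subseteq> sphere 0 1" using nz by (auto simp: norm_sgn)
  ultimately show ?thesis
    using assms by (intro bodies_inI) (auto simp: convex_body_def spherical_convex_def inner_sgn_pos_iff)
qed

text \<open>A convex cone containing the radial projection of \<open>A\<close> contains
  \<open>A\<close>, hence its Euclidean hull, which avoids \<open>0\<close> by positivity. Spherical
  hulls thereby reduce to Euclidean ones.\<close>

lemma sconv_sgn_image:
  assumes "compact A" "A \<noteq> {}" and pos: "\<And>x. x \<in> A \<Longrightarrow> u \<bullet> x > 0"
  shows "sconv (sgn ` A) = sgn ` (convex hull A)" (is "_ = ?N")
    and "sgn ` (convex hull A) \<in> bodies_in u"
proof -
  have "convex hull A \<subseteq> {x. u \<bullet> x > 0}"
    using pos by (intro hull_minimal) (auto simp: convex_halfspace_gt)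
  then show N: "?N \<in> bodies_in u"
    using assms by (intro sgn_image_bodies_in) (auto simp: compact_convex_hull)
  show "sconv (sgn ` A) = ?N"
  proof
    show "sconv (sgn ` A) \<subseteq> ?N"
      using bodies_inD(4)[OF N] by (intro hull_minimal image_mono hull_subset)
    have "?N \<subseteq> B" if B: "spherical_convex B" "sgn ` A \<subseteq> B" for B
    proof -
      have "A \<subseteq> rad (sgn ` A)"
        by (metis rad_sgn_image rad_eq_conic_hull hull_subset)
      also have "\<dots> \<subseteq> rad B" using B(2) by (auto simp: rad_def)
      finally have "convex hull A \<subseteq> rad B"
        using B(1) by (intro hull_minimal) (auto simp: spherical_convex_def)
      moreover have "sgn x \<in> B" if "x \<in> rad B" "x \<noteq> 0" for x
        using that B(1) by (auto simp: rad_def spherical_convex_def sgn_div_norm)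
      moreover have "0 \<notin> convex hull A"
        using \<open>convex hull A \<subseteq> {x. u \<bullet> x > 0}\<close> by auto
      ultimately show ?thesis by (metis image_subsetI subsetD)
    qed
    then show "?N \<subseteq> sconv (sgn ` A)" by (auto simp: hull_def)
  qed
qed

lemma sgn_image_sphere: "A \<subseteq> sphere 0 1 \<Longrightarrow> sgn ` A = A" for A :: "'a::euclidean_space set"
  by (force simp: sgn_div_norm)

lemma sconv_bodies:
  assumes "K \<in> bodies_in u" "L \<in> bodies_in u"
  shows "sconv (K \<union> L) = sgn ` (convex hull (K \<union> L))" "sconv (K \<union> L) \<in> bodies_in u"
proof -
  note K = bodies_inD[OF assms(1)] and L = bodies_inD[OF assms(2)]
  have "compact (K \<union> L)" "K \<union> L \<noteq> {}" "\<And>x. x \<in> K \<union> L \<Longrightarrow> u \<bullet> x > 0"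
    using K L by auto
  note * = sconv_sgn_image[OF this]
  have "sgn ` (K \<union> L) = K \<union> L" using K(5) L(5) by (intro sgn_image_sphere) auto
  with * show "sconv (K \<union> L) = sgn ` (convex hull (K \<union> L))" "sconv (K \<union> L) \<in> bodies_in u" by auto
qed

lemma body_eq_sgn_convex_hull:
  assumes "K \<in> bodies_in u"
  shows "K = sgn ` (convex hull K)"
proof -
  have "sconv K = K" using bodies_inD(4)[OF assms]
    by (rule hull_same)
  then show ?thesis using sconv_bodies(1)[OF assms assms] by simp
qed

section \<open>Slopes form intervals and determine the body\<close>

lemma slopes_sgn_image: "slopes u y (sgn ` X) = slopes u y X"
proof -
  have "(y \<bullet> sgn x) / (u \<bullet> sgn x) = (y \<bullet> x) / (u \<bullet> x)" for x
    by (cases "x = 0") (simp_all add: sgn_div_norm)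
  then show ?thesis unfolding slopes_def image_image by simp
qed

text \<open>Passing from \<open>K\<close> to its Euclidean hull keeps the slopes and makes the
  domain convex, hence connected; the slope is continuous there because \<open>u \<bullet> x\<close>
  stays positive.\<close>

lemma slopes_body_interval:
  assumes "K \<in> bodies_in u"
  obtains a b where "a \<le> b" "slopes u y K = {a..b}"
proof -
  let ?X = "convex hull K"
  have "?X \<subseteq> {x. u \<bullet> x > 0}"
    using bodies_inD[OF assms] by (intro hull_minimal) (auto simp: convex_halfspace_gt)
  then have pos: "u \<bullet> x > 0" if "x \<in> ?X" for x using that by auto
  have eq: "slopes u y K = slopes u y ?X"
    using slopes_sgn_image body_eq_sgn_convex_hull[OF assms] by metis
  have c: "continuous_on ?X (\<lambda>k. (y \<bullet> k) / (u \<bullet> k))"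
    using pos by (intro continuous_intros) force
  have "compact (slopes u y K)"
    unfolding eq unfolding slopes_def
    using bodies_inD(2)[OF assms] by (intro compact_continuous_image[OF c] compact_convex_hull)
  moreover have "connected (slopes u y K)"
    unfolding eq unfolding slopes_def
    by (intro connected_continuous_image[OF c] convex_connected convex_convex_hull)
  ultimately obtain a b where ab: "slopes u y K = {a..b}"
    using connected_compact_interval_1 by blast
  moreover have "slopes u y K \<noteq> {}" using bodies_inD(1)[OF assms] by (simp add: slopes_def)
  ultimately show ?thesis using that by auto
qed

lemma arc_bodies_in:
  assumes "u \<bullet> p > 0" "u \<bullet> q > 0"
  shows "arc p q \<in> bodies_in u"
  unfolding arc_def
proof (rule sgn_image_bodies_in)
  have "closed_segment p q \<subseteq> {x. u \<bullet> x > 0}"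
    using assms by (intro closed_segment_subset) (auto simp: convex_halfspace_gt)
  then show "\<And>x. x \<in> closed_segment p q \<Longrightarrow> u \<bullet> x > 0" by auto
qed auto

lemma slopes_arc:
  assumes "u \<bullet> p = 1" "u \<bullet> q = 1"
  shows "slopes u y (arc p q) = closed_segment (y \<bullet> p) (y \<bullet> q)"
proof -
  have "closed_segment p q \<subseteq> {x. u \<bullet> x = 1}"
    using assms by (intro closed_segment_subset) (auto simp: convex_hyperplane)
  then have one: "u \<bullet> x = 1" if "x \<in> closed_segment p q" for x using that by auto
  have "slopes u y (arc p q) = slopes u y (closed_segment p q)"
    unfolding arc_def by (rule slopes_sgn_image)
  also have "\<dots> = (\<lambda>x. y \<bullet> x) ` closed_segment p q"
    unfolding slopes_def by (intro image_cong refl) (simp add: one)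
  also have "\<dots> = closed_segment (y \<bullet> p) (y \<bullet> q)"
    by (rule closed_segment_linear_image[symmetric])
      (intro bounded_linear.linear bounded_linear_inner_right)
  finally show ?thesis .
qed

text \<open>Slope bounds are linear half-space conditions where \<open>u\<close> is positive, so
  they survive convex hulls; conversely the slopes of the hull form an interval containing both
  given ones.\<close>

lemma slopes_sconv:
  assumes K: "K \<in> bodies_in u" "slopes u y K = {a..b}" and L: "L \<in> bodies_in u" "slopes u y L = {c..d}"
  shows "slopes u y (sconv (K \<union> L)) = {min a c..max b d}"
proof -
  let ?X = "convex hull (K \<union> L)"
  have ne: "a \<le> b" "c \<le> d"
    using bodies_inD(1)[OF K(1)] bodies_inD(1)[OF L(1)] K(2) L(2) by (force simp: slopes_def)+
  have uK: "u \<bullet> k > 0" if "k \<in> K \<union> L" for k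
    using that bodies_inD(6)[OF K(1)] bodies_inD(6)[OF L(1)] by auto
  have "?X \<subseteq> {x. u \<bullet> x > 0}"
    using uK by (intro hull_minimal) (auto simp: convex_halfspace_gt)
  then have pos: "u \<bullet> x > 0" if "x \<in> ?X" for x using that by auto
  have sl: "min a c \<le> (y \<bullet> k) / (u \<bullet> k)" "(y \<bullet> k) / (u \<bullet> k) \<le> max b d" if "k \<in> K \<union> L" for k
  proof -
    have "(y \<bullet> k) / (u \<bullet> k) \<in> {a..b} \<union> {c..d}"
      using that unfolding K(2)[symmetric] L(2)[symmetric] by (auto simp: slopes_def)
    then show "min a c \<le> (y \<bullet> k) / (u \<bullet> k)" "(y \<bullet> k) / (u \<bullet> k) \<le> max b d" by auto
  qed
  have eq: "slopes u y (sconv (K \<union> L)) = slopes u y ?X"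
    using sconv_bodies(1)[OF K(1) L(1)] by (simp add: slopes_sgn_image)
  have "?X \<subseteq> {x. (y - min a c *\<^sub>R u) \<bullet> x \<ge> 0}" "?X \<subseteq> {x. (y - max b d *\<^sub>R u) \<bullet> x \<le> 0}"
    using sl uK by (intro hull_minimal convex_halfspace_ge convex_halfspace_le;
        force simp: inner_diff_left field_simps)+
  then have "slopes u y ?X \<subseteq> {min a c..max b d}"
    using pos by (force simp: slopes_def inner_diff_left field_simps)
  moreover have "{a..b} \<union> {c..d} \<subseteq> slopes u y ?X"
    unfolding K(2)[symmetric] L(2)[symmetric] using hull_subset[of "K \<union> L" convex] by (auto simp: slopes_def)
  moreover obtain p q where "slopes u y (sconv (K \<union> L)) = {p..q}"
    using slopes_body_interval[OF sconv_bodies(2)[OF K(1) L(1)]] by metis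
  ultimately show ?thesis using ne eq by auto
qed

text \<open>A point of \<open>M\<close> outside \<open>N\<close> can be separated from the closed
  convex cone over \<open>N\<close>; the normal \<open>y\<close> then gives this point a negative
  slope and all of \<open>N\<close> nonnegative ones.\<close>

lemma bodies_subset_by_slopes:
  assumes M: "M \<in> bodies_in u" "N \<in> bodies_in u" and u: "u \<noteq> 0"
    and le: "\<And>y. y \<notin> span {u} \<Longrightarrow> slopes u y M \<subseteq> slopes u y N"
  shows "M \<subseteq> N"
proof (rule ccontr)
  assume "\<not> M \<subseteq> N"
  then obtain m where m: "m \<in> M" "m \<notin> N" by auto
  have mr: "m \<notin> conic hull N"
  proof
    assume "m \<in> conic hull N"
    then obtain l k where lk: "m = l *\<^sub>R k" "0 \<le> l" "k \<in> N" by (auto simp: conic_hull_explicit)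
    then have "l = 1" using bodies_inD(7)[OF M(1) m(1)] bodies_inD(7)[OF M(2) lk(3)] by simp
    then show False using lk m by simp
  qed
  have "0 \<notin> N" using bodies_inD(6)[OF M(2)] by force
  then have "closed (conic hull N)" using bodies_inD(2)[OF M(2)] closed_conic_hull by blast
  moreover have "convex (conic hull N)" using bodies_inD(3)[OF M(2)] by (simp add: rad_eq_conic_hull)
  ultimately obtain y b where y: "y \<bullet> m < b" "\<And>x. x \<in> conic hull N \<Longrightarrow> y \<bullet> x > b"
    using separating_hyperplane_closed_point mr by metis
  obtain k0 where k0: "k0 \<in> N" using bodies_inD(1)[OF M(2)] by auto
  have cone: "l *\<^sub>R k \<in> conic hull N" if "0 \<le> l" "k \<in> N" for l k
    using that by (auto simp: conic_hull_explicit)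
  have b0: "b < 0" using y(2)[OF cone[OF order_refl k0]] by simp
  \<comment> \<open>A linear form bounded below on a cone is nonnegative there: a negative value
    could be scaled to equal \<open>b\<close>.\<close>
  have pos: "y \<bullet> k \<ge> 0" if "k \<in> N" for k
  proof (rule ccontr)
    assume "\<not> y \<bullet> k \<ge> 0"
    then have "y \<bullet> ((b / (y \<bullet> k)) *\<^sub>R k) > b"
      using b0 that by (intro y(2) cone) (auto simp: divide_nonpos_neg)
    then show False using \<open>\<not> y \<bullet> k \<ge> 0\<close> by simp
  qed
  have neg: "y \<bullet> m < 0" using y(1) b0 by simp
  show False
  proof (cases "y \<in> span {u}")
    \<comment> \<open>A multiple of \<open>u\<close> has the same sign at \<open>m\<close> and on
      \<open>N\<close>.\<close>
    case True
    then obtain s where s: "y = s *\<^sub>R u" by (auto simp: span_singleton)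
    have "s < 0" using neg bodies_inD(6)[OF M(1) m(1)] by (simp add: s mult_less_0_iff)
    then show False using pos[OF k0] bodies_inD(6)[OF M(2) k0] by (simp add: s zero_le_mult_iff)
  next
    case False
    have "(y \<bullet> m) / (u \<bullet> m) \<in> slopes u y N"
      using le[OF False] m(1) by (auto simp: slopes_def)
    then obtain k where "k \<in> N" "(y \<bullet> m) / (u \<bullet> m) = (y \<bullet> k) / (u \<bullet> k)" by (auto simp: slopes_def)
    moreover have "(y \<bullet> m) / (u \<bullet> m) < 0" using neg bodies_inD(6)[OF M(1) m(1)] by (simp add: divide_neg_pos)
    ultimately show False
      using pos bodies_inD(6)[OF M(2)] by (smt (verit) divide_nonneg_pos)
  qed
qed

subsection \<open>Projectively covariant operations on intervals\<close>

text \<open>Endpoints of \<open>closed_segment\<close> are unordered: no argument is empty, and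
  \<open>subadditive\<close> may add endpoints in opposite orders. Positivity in
  \<open>projective\<close> keeps the pole of the map off both arguments.\<close>

locale interval_operation =
  fixes \<Phi> :: "real set \<Rightarrow> real set \<Rightarrow> real set"
  assumes interval: "\<exists>p q. p \<le> q \<and> \<Phi> (closed_segment a b) (closed_segment c d) = {p..q}"
    and projective: "\<lbrakk>\<alpha> * \<delta> - \<beta> * \<gamma> \<noteq> 0; \<And>t. t \<in> closed_segment a b \<union> closed_segment c d \<Longrightarrow> \<alpha> + \<beta> * t > 0\<rbrakk> \<Longrightarrow>
      \<Phi> ((\<lambda>t. (\<gamma> + \<delta> * t) / (\<alpha> + \<beta> * t)) ` closed_segment a b)
        ((\<lambda>t. (\<gamma> + \<delta> * t) / (\<alpha> + \<beta> * t)) ` closed_segment c d) =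
      (\<lambda>t. (\<gamma> + \<delta> * t) / (\<alpha> + \<beta> * t)) ` \<Phi> (closed_segment a b) (closed_segment c d)"
    and lower: "\<lbrakk>closed_segment a b \<subseteq> {s..}; closed_segment c d \<subseteq> {s..}\<rbrakk> \<Longrightarrow>
      \<Phi> (closed_segment a b) (closed_segment c d) \<subseteq> {s..}"
    and subadditive: "z \<in> \<Phi> (closed_segment (a1 + a2) (b1 + b2)) (closed_segment (c1 + c2) (d1 + d2)) \<Longrightarrow>
      \<exists>z1 \<in> \<Phi> (closed_segment a1 b1) (closed_segment c1 d1).
      \<exists>z2 \<in> \<Phi> (closed_segment a2 b2) (closed_segment c2 d2). z = z1 + z2"
begin

text \<open>The axioms are symmetric, so every result on the first argument is available for the
  second.\<close>

lemma swap: "interval_operation (\<lambda>I J. \<Phi> J I)"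
proof
  fix a b c d
  show "\<exists>p q. p \<le> q \<and> \<Phi> (closed_segment c d) (closed_segment a b) = {p..q}"
    by (rule interval)
next
  fix z a1 a2 b1 b2 c1 c2 d1 d2
  assume "z \<in> \<Phi> (closed_segment (c1 + c2) (d1 + d2)) (closed_segment (a1 + a2) (b1 + b2))"
  then show "\<exists>z1 \<in> \<Phi> (closed_segment c1 d1) (closed_segment a1 b1).
      \<exists>z2 \<in> \<Phi> (closed_segment c2 d2) (closed_segment a2 b2). z = z1 + z2"
    by (rule subadditive)
next
  fix \<alpha> \<delta> \<beta> \<gamma> a b c d :: real
  assume nd: "\<alpha> * \<delta> - \<beta> * \<gamma> \<noteq> 0"
    and pos: "\<And>t. t \<in> closed_segment a b \<union> closed_segment c d \<Longrightarrow> \<alpha> + \<beta> * t > 0"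
  show "\<Phi> ((\<lambda>t. (\<gamma> + \<delta> * t) / (\<alpha> + \<beta> * t)) ` closed_segment c d)
        ((\<lambda>t. (\<gamma> + \<delta> * t) / (\<alpha> + \<beta> * t)) ` closed_segment a b) =
      (\<lambda>t. (\<gamma> + \<delta> * t) / (\<alpha> + \<beta> * t)) ` \<Phi> (closed_segment c d) (closed_segment a b)"
    by (rule projective[OF nd]) (rule pos, simp only: Un_commute)
qed (rule lower)

lemma affine:
  assumes "\<delta> \<noteq> 0"
  shows "\<Phi> (closed_segment (\<gamma> + \<delta> * a) (\<gamma> + \<delta> * b)) (closed_segment (\<gamma> + \<delta> * c) (\<gamma> + \<delta> * d)) =
    (\<lambda>t. \<gamma> + \<delta> * t) ` \<Phi> (closed_segment a b) (closed_segment c d)"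
proof -
  have lin: "linear ((*) \<delta>)" for \<delta> :: real by (intro linearI) (auto simp: algebra_simps)
  have "closed_segment (\<gamma> + \<delta> * a) (\<gamma> + \<delta> * b) = (\<lambda>t. \<gamma> + \<delta> * t) ` closed_segment a b" for a b
    by (simp add: closed_segment_translation closed_segment_linear_image[OF lin] image_image)
  then show ?thesis using projective[of 1 \<delta> 0 \<gamma> a b c d] assms by simp
qed

text \<open>Reflection in \<open>0\<close> is an admissible map and turns this into
  \<open>lower\<close>.\<close>

lemma upper:
  assumes "closed_segment a b \<subseteq> {..s}" "closed_segment c d \<subseteq> {..s}"
  shows "\<Phi> (closed_segment a b) (closed_segment c d) \<subseteq> {..s}"
proof -
  have "closed_segment (- a) (- b) \<subseteq> {- s..}" "closed_segment (- c) (- d) \<subseteq> {- s..}"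
    using assms by (auto simp: closed_segment_eq_real_ivl split: if_splits)
  from lower[OF this] show ?thesis using affine[of "-1" 0 a b c d] by auto
qed

text \<open>The value lies in \<open>{0..1}\<close> and is invariant under the increasing projective
  map \<open>?g\<close>, whose only fixed points are \<open>0\<close> and \<open>1\<close>; the ends
  of an invariant interval must be fixed.\<close>

lemma points_01:
  obtains p q where "\<Phi> {0} {1} = {p..q}" "p \<le> q" "p = 0 \<or> p = 1" "q = 0 \<or> q = 1"
proof -
  obtain p q where pq: "\<Phi> {0} {1} = {p..q}" "p \<le> q" using interval[of 0 0 1 1] by auto
  have b: "0 \<le> p" "q \<le> 1"
    using lower[of 0 0 0 1 1] upper[of 0 0 1 1 1] pq by auto
  let ?g = "\<lambda>t::real. 2 * t / (1 + t)"
  have pos: "1 + 1 * t > 0" if "t \<in> closed_segment 0 0 \<union> closed_segment 1 1" for t :: real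
    using that by auto
  have "?g ` \<Phi> {0} {1} = \<Phi> {0} {1}"
    using projective[of 1 2 1 0 0 0 1 1, OF _ pos, symmetric] by simp
  then have inv: "?g ` {p..q} = {p..q}" by (simp only: pq(1))
  have mono: "?g s \<le> ?g t" if "0 \<le> s" "s \<le> t" for s t :: real
    using that by (simp add: field_simps)
  have "?g t \<in> {p..q}" if "t \<in> {p..q}" for t
    using imageI[OF that, of ?g] unfolding inv .
  then have "?g p \<in> {p..q}" "?g q \<in> {p..q}" using pq(2) by simp_all
  moreover have "p \<in> ?g ` {p..q}" "q \<in> ?g ` {p..q}" unfolding inv using pq(2) by simp_all
  then obtain s t where "p = ?g s" "s \<in> {p..q}" "q = ?g t" "t \<in> {p..q}" by blast
  ultimately have "p = ?g p" "q = ?g q"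
    using mono[of p s] mono[of t q] b by auto
  then have "p * (p - 1) = 0" "q * (q - 1) = 0" using b pq(2) by (simp_all add: field_simps)
  then show ?thesis using that pq by auto
qed

text \<open>An affine map carries \<open>0\<close> and \<open>1\<close> to \<open>a\<close> and
  \<open>c\<close> if these differ. For \<open>a = c\<close> such a map is not injective, and the
  bounds \<open>lower\<close> and \<open>upper\<close> pin the value to \<open>{c}\<close>.\<close>

lemma points:
  "\<Phi> {a} {c} = (\<lambda>t. a + (c - a) * t) ` \<Phi> {0} {1}"
proof (cases "a = c")
  case True
  obtain p q where "\<Phi> {c} {c} = {p..q}" "p \<le> q" using interval[of c c c c] by auto
  moreover have "\<Phi> {c} {c} \<subseteq> {c..}" "\<Phi> {c} {c} \<subseteq> {..c}" using lower[of c c c c c] upper[of c c c c c] by auto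
  ultimately have "\<Phi> {c} {c} = {c}" by auto
  moreover obtain p' q' where "\<Phi> {0} {1} = {p'..q'}" "p' \<le> q'" using interval[of 0 0 1 1] by auto
  ultimately show ?thesis using True by auto
next
  case False
  then show ?thesis using affine[of "c - a" a 0 0 1 1] by simp
qed

text \<open>The endpoint pairs \<open>a, b\<close> and \<open>b, a\<close> add up to the single
  point \<open>a + b\<close>, and likewise for \<open>c, d\<close>. Subadditivity splits
  \<open>a + b\<close> into two points of one and the same interval, which contains their
  mean.\<close>

lemma left_midpoint:
  assumes "0 \<in> \<Phi> {0} {1}"
  shows "(a + b) / 2 \<in> \<Phi> (closed_segment a b) (closed_segment c d)"
proof -
  have "a + b \<in> \<Phi> {a + b} {c + d}" using assms by (simp add: points[of "a + b"] image_iff) force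
  then obtain z1 z2 where z: "a + b = z1 + z2" "z1 \<in> \<Phi> (closed_segment a b) (closed_segment c d)"
     "z2 \<in> \<Phi> (closed_segment b a) (closed_segment d c)"
    using subadditive[of "a + b" a b b a c d d c] by (auto simp: add.commute)
  obtain p q where "\<Phi> (closed_segment a b) (closed_segment c d) = {p..q}" using interval by blast
  with z show ?thesis by (auto simp: closed_segment_commute field_simps)
qed

text \<open>Letting the pole of a projective map tend to \<open>a\<close> from below moves the midpoint to \<open>a\<close>.\<close>

lemma left_end:
  assumes 0: "0 \<in> \<Phi> {0} {1}" and ab: "a \<le> b" and cd: "c \<le> d" and ac: "a \<le> c"
  shows "a \<in> \<Phi> {a..b} {c..d}"
proof -
  have seg: "{a..b} = closed_segment a b" "{c..d} = closed_segment c d"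
    using ab cd by (simp_all add: closed_segment_eq_real_ivl)
  obtain p q where pq: "p \<le> q" "\<Phi> {a..b} {c..d} = {p..q}" unfolding seg using interval by blast
  have ap: "a \<le> p" using lower[of a b a c d] ab cd ac pq unfolding seg[symmetric] by auto
  have "p \<le> a + e" if e: "e > 0" for e
  proof -
    \<comment> \<open>The pole \<open>a - e\<close> lies just below all arguments, so the map is
      decreasing and takes the large value \<open>1 / e\<close> at \<open>a\<close>.\<close>
    let ?g = "\<lambda>t. 1 / (t - a + e)"
    have img: "?g ` {s..t} = closed_segment (?g s) (?g t)" if st: "a \<le> s" "s \<le> t" for s t
    proof -
      have "?g t \<le> ?g s" using st e by (intro divide_left_mono) auto
      moreover have "?g ` {s..t} = {?g t..?g s}"
      proof (intro equalityI subsetI)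
        fix y assume "y \<in> ?g ` {s..t}"
        then show "y \<in> {?g t..?g s}" using st e by (auto intro!: divide_left_mono)
      next
        fix y assume y: "y \<in> {?g t..?g s}"
        have "0 < ?g t" using st e by simp
        moreover have "?g t \<le> y" using y by (simp only: atLeastAtMost_iff)
        ultimately have y0: "0 < y" by (rule order_less_le_trans)
        have "y * (s - a + e) \<le> 1" "1 \<le> y * (t - a + e)" using y st e by (auto simp: field_simps)
        then have "s \<le> 1 / y + a - e" "1 / y + a - e \<le> t" using y0 by (auto simp: field_simps)
        then show "y \<in> ?g ` {s..t}" by (intro image_eqI[of _ _ "1 / y + a - e"]) simp_all
      qed
      ultimately show ?thesis by (simp add: closed_segment_eq_real_ivl)
    qed
    have "(?g a + ?g b) / 2 \<in> \<Phi> (?g ` {a..b}) (?g ` {c..d})"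
      using left_midpoint[OF 0] img[of a b] img[of c d] ab cd ac by simp
    also have "\<dots> = ?g ` \<Phi> {a..b} {c..d}"
    proof -
      have *: "(\<lambda>t. (1 + 0 * t) / ((e - a) + 1 * t)) = ?g" by (auto simp: algebra_simps)
      have "(e - a) + 1 * t > 0" if "t \<in> closed_segment a b \<union> closed_segment c d" for t
        using that ab cd ac e unfolding seg[symmetric] by auto
      from projective[OF _ this, of 0 1, unfolded *] show ?thesis unfolding seg by simp
    qed
    finally obtain t where t: "t \<in> {p..q}" "(?g a + ?g b) / 2 = ?g t" using pq by auto
    \<comment> \<open>The midpoint exceeds half of \<open>?g a = 1 / e\<close>, so its preimage is
      at most \<open>a + e\<close>.\<close>
    have "0 < ?g b" using ab e by simp
    then have "1 / (2 * e) \<le> ?g t" unfolding t(2)[symmetric] by simp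
    then have "t \<le> a + e" using t ap e by (simp add: field_simps)
    then show ?thesis using t by simp
  qed
  then have "p \<le> a" by (rule field_le_epsilon)
  then show ?thesis using ap pq by auto
qed

lemma reflect: "a \<le> b \<Longrightarrow> c \<le> d \<Longrightarrow> \<Phi> {- b..- a} {- d..- c} = uminus ` \<Phi> {a..b} {c..d}"
  using affine[of "-1" 0 a b c d] by (simp add: closed_segment_eq_real_ivl split: if_splits)

lemma right_end:
  assumes "0 \<in> \<Phi> {0} {1}" "a \<le> b" "c \<le> d" "d \<le> b"
  shows "b \<in> \<Phi> {a..b} {c..d}"
  using left_end[of "- b" "- a" "- d" "- c"] assms reflect[of a b c d] by auto

text \<open>Since \<open>\<Phi> {0} {s} = {0}\<close>, subadditivity makes the value invariant under
  translations of the second argument. Aligning first the left and then the right ends puts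
  \<open>a\<close> and \<open>b\<close> into the value, and the one-sided bounds exclude anything
  more.\<close>

lemma left_operation:
  assumes 01: "\<Phi> {0} {1} = {0}" and ab: "a \<le> b" and cd: "c \<le> d"
  shows "\<Phi> {a..b} {c..d} = {a..b}"
proof -
  have le: "\<Phi> {a..b} {c + s..d + s} \<subseteq> \<Phi> {a..b} {c..d}" if "c \<le> d" for c d s
  proof
    fix z assume "z \<in> \<Phi> {a..b} {c + s..d + s}"
    then have "z \<in> \<Phi> (closed_segment (a + 0) (b + 0)) (closed_segment (c + s) (d + s))"
      using ab that by (simp add: closed_segment_eq_real_ivl)
    then obtain z1 z2 where "z1 \<in> \<Phi> (closed_segment a b) (closed_segment c d)"
        "z2 \<in> \<Phi> (closed_segment 0 0) (closed_segment s s)" "z = z1 + z2"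
      using subadditive by blast
    then show "z \<in> \<Phi> {a..b} {c..d}"
      using ab that by (simp add: closed_segment_eq_real_ivl points[of 0 s] 01)
  qed
  have shift: "\<Phi> {a..b} {c + s..d + s} = \<Phi> {a..b} {c..d}" for s
    using le[of c d s] le[of "c + s" "d + s" "- s"] cd by simp
  obtain p q where pq: "\<Phi> {a..b} {c..d} = {p..q}"
    using interval[of a b c d] ab cd by (auto simp: closed_segment_eq_real_ivl)
  let ?s = "a - c" and ?t = "b - d"
  have "a \<in> \<Phi> {a..b} {c..d}" "\<Phi> {a..b} {c..d} \<subseteq> {a..}"
    using left_end[of a b "c + ?s" "d + ?s"] lower[of a b a "c + ?s" "d + ?s"] ab cd
    unfolding shift[of ?s] by (auto simp: 01 closed_segment_eq_real_ivl shift[of ?s, simplified])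
  moreover have "b \<in> \<Phi> {a..b} {c..d}" "\<Phi> {a..b} {c..d} \<subseteq> {..b}"
    using right_end[of a b "c + ?t" "d + ?t"] upper[of a b b "c + ?t" "d + ?t"] ab cd
    unfolding shift[of ?t] by (auto simp: 01 closed_segment_eq_real_ivl shift[of ?t, simplified])
  ultimately show ?thesis using pq by auto
qed

text \<open>The midpoint hypothesis holds for both orders of the arguments, so
  \<open>left_end\<close> and \<open>right_end\<close> apply to whichever argument reaches further
  out.\<close>

lemma hull_operation:
  assumes 01: "\<Phi> {0} {1} = {0..1}" and ab: "a \<le> b" and cd: "c \<le> d"
  shows "\<Phi> {a..b} {c..d} = {min a c..max b d}"
proof -
  interpret sw: interval_operation "\<lambda>I J. \<Phi> J I" by (rule swap)
  have 0: "0 \<in> \<Phi> {0} {1}" using 01 by simp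
  have 1: "0 \<in> \<Phi> {1} {0}" using points[of 1 0] by (force simp: 01)
  obtain p q where pq: "\<Phi> {a..b} {c..d} = {p..q}"
    using interval[of a b c d] ab cd by (auto simp: closed_segment_eq_real_ivl)
  have "min a c \<in> \<Phi> {a..b} {c..d}"
    using left_end[OF 0 ab cd] sw.left_end[OF 1 cd ab] by (auto simp: min_def)
  moreover have "max b d \<in> \<Phi> {a..b} {c..d}"
    using right_end[OF 0 ab cd] sw.right_end[OF 1 cd ab] by (auto simp: max_def)
  moreover have "\<Phi> {a..b} {c..d} \<subseteq> {min a c..}" "\<Phi> {a..b} {c..d} \<subseteq> {..max b d}"
    using lower[of a b "min a c" c d] upper[of a b "max b d" c d] ab cd
    by (auto simp: closed_segment_eq_real_ivl)
  ultimately show ?thesis using pq by auto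
qed

theorem classification:
  "(\<forall>a b c d. a \<le> b \<longrightarrow> c \<le> d \<longrightarrow> \<Phi> {a..b} {c..d} = {a..b}) \<or>
   (\<forall>a b c d. a \<le> b \<longrightarrow> c \<le> d \<longrightarrow> \<Phi> {a..b} {c..d} = {c..d}) \<or>
   (\<forall>a b c d. a \<le> b \<longrightarrow> c \<le> d \<longrightarrow> \<Phi> {a..b} {c..d} = {min a c..max b d})"
proof -
  interpret sw: interval_operation "\<lambda>I J. \<Phi> J I" by (rule swap)
  obtain p q where pq: "\<Phi> {0} {1} = {p..q}" "p \<le> q" "p = 0 \<or> p = 1" "q = 0 \<or> q = 1"
    by (rule points_01)
  consider "\<Phi> {0} {1} = {0}" | "\<Phi> {0} {1} = {1}" | "\<Phi> {0} {1} = {0..1}" using pq by fastforce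
  then show ?thesis
  proof cases
    case 1
    then show ?thesis using left_operation by blast
  next
    case 2
    then have "\<Phi> {1} {0} = {0}" using points[of 1 0] by simp
    then show ?thesis using sw.left_operation by blast
  next
    case 3
    then show ?thesis using hull_operation by blast
  qed
qed

end

subsection \<open>Operations determined by slopes\<close>

text \<open>The vector \<open>adjoint h 1\<close> represents the linear form \<open>h\<close>
  prescribed on the independent triple.\<close>

lemma exists_inner_eq3:
  fixes a b c :: "'a::euclidean_space"
  assumes "a \<noteq> 0" "b \<notin> span {a}" "c \<notin> span {a, b}"
  obtains e where "a \<bullet> e = \<alpha>" "b \<bullet> e = \<beta>" "c \<bullet> e = \<gamma>"
proof -
  have ne: "b \<noteq> a" "c \<noteq> a" "c \<noteq> b" using assms by (auto simp: span_base)
  have "independent {b, a}" using assms(1,2) by (simp add: independent_insert)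
  moreover have "c \<notin> span {b, a}" using assms(3) by (simp add: insert_commute)
  ultimately have ind: "independent {c, b, a}"
    using ne by (simp add: independent_insert)
  obtain h :: "'a \<Rightarrow> real" where h: "linear h" "h a = \<alpha>" "h b = \<beta>" "h c = \<gamma>"
    using linear_independent_extend[OF ind, of "\<lambda>x. if x = a then \<alpha> else if x = b then \<beta> else \<gamma>"] ne
    by auto
  have "x \<bullet> adjoint h 1 = h x" for x using adjoint_works[OF h(1), of x 1] by simp
  then show ?thesis using that h by metis
qed

text \<open>Planes are null sets from dimension three on, so three of them cannot fill the
  space.\<close>

lemma exists_outside_planes:
  fixes a b c d e f :: "'a::euclidean_space"
  assumes "3 \<le> DIM('a)"
  obtains z where "z \<notin> span {a, b}" "z \<notin> span {c, d}" "z \<notin> span {e, f}"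
proof -
  have "negligible (span {a, b})" for a b :: 'a
  proof (rule negligible_lowdim)
    have "dim (span {a, b}) \<le> card {a, b}" unfolding dim_span by (rule dim_le_card') simp
    also have "\<dots> \<le> 2" by (simp add: card_insert_if)
    finally show "dim (span {a, b}) < DIM('a)" using assms by simp
  qed
  then have "negligible (span {a, b} \<union> span {c, d} \<union> span {e, f})" by (intro negligible_Un)
  then have "span {a, b} \<union> span {c, d} \<union> span {e, f} \<noteq> UNIV" using non_negligible_UNIV by metis
  then show ?thesis using that by blast
qed

text \<open>The sign is already removed: \<open>g K L\<close> stays in every open half-space that
  contains both arguments. Poles are not normalised, which permits tilting them.\<close>

locale hemispheric_operation =
  fixes g :: "'a::euclidean_space set \<Rightarrow> 'a set \<Rightarrow> 'a set"
  assumes dim3: "3 \<le> DIM('a)"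
    and closed_op: "\<lbrakk>K \<in> bodies_in u; L \<in> bodies_in u\<rbrakk> \<Longrightarrow> g K L \<in> bodies_in u"
    and slopes_cong: "\<lbrakk>y \<notin> span {u}; K \<in> bodies_in u; K' \<in> bodies_in u; L \<in> bodies_in u; L' \<in> bodies_in u;
      slopes u y K = slopes u y K'; slopes u y L = slopes u y L'\<rbrakk> \<Longrightarrow>
      slopes u y (g K L) = slopes u y (g K' L')"
begin

text \<open>Closed half-spaces are limits of open ones: tilting \<open>y\<close> slightly towards
  \<open>u\<close> makes it positive on both arguments while it would stay negative at a violating
  \<open>m\<close>.\<close>

lemma nonneg_op:
  assumes K: "K \<in> bodies_in u" and L: "L \<in> bodies_in u"
    and ge: "\<And>k. k \<in> K \<union> L \<Longrightarrow> y \<bullet> k \<ge> 0" and m: "m \<in> g K L"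
  shows "y \<bullet> m \<ge> 0"
proof (rule ccontr)
  assume neg: "\<not> y \<bullet> m \<ge> 0"
  have um: "u \<bullet> m > 0" using bodies_inD(6)[OF closed_op[OF K L] m] .
  \<comment> \<open>This value gives \<open>?v \<bullet> m = (y \<bullet> m) / 2\<close>.\<close>
  define e where "e = - (y \<bullet> m) / (2 * (u \<bullet> m))"
  have e: "e > 0" using neg um by (simp add: e_def divide_neg_pos)
  let ?v = "y + e *\<^sub>R u"
  have "?v \<bullet> k > 0" if "k \<in> K \<union> L" for k
  proof -
    have "u \<bullet> k > 0" using that bodies_inD(6)[OF K] bodies_inD(6)[OF L] by auto
    then show ?thesis using ge[OF that] e by (simp add: inner_add_left add_nonneg_pos)
  qed
  then have "K \<in> bodies_in ?v" "L \<in> bodies_in ?v"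
    using bodies_in_change[OF K] bodies_in_change[OF L] by auto
  from bodies_inD(6)[OF closed_op[OF this] m] have "0 < y \<bullet> m + e * (u \<bullet> m)" by (simp add: inner_add_left)
  also have "\<dots> = (y \<bullet> m) / 2" using um by (simp add: e_def field_simps)
  finally show False using neg by simp
qed

text \<open>Two opposite closed half-spaces transfer linear relations from the arguments to the
  result.\<close>

lemma eq_op:
  assumes K: "K \<in> bodies_in u" and L: "L \<in> bodies_in u"
    and eq: "\<And>k. k \<in> K \<union> L \<Longrightarrow> y \<bullet> k = z \<bullet> k" and m: "m \<in> g K L"
  shows "y \<bullet> m = z \<bullet> m"
  using nonneg_op[OF K L _ m, of "y - z"] nonneg_op[OF K L _ m, of "z - y"] eq
  by (force simp: inner_diff_left)

section \<open>Independence of the slope law from pole and direction\<close>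

text \<open>Both pairs induce the same map on slopes; this is expressed before any such map has been
  named.\<close>

definition compatible :: "'a \<Rightarrow> 'a \<Rightarrow> 'a \<Rightarrow> 'a \<Rightarrow> bool" where
  "compatible u y u' y' \<longleftrightarrow> (\<forall>K \<in> bodies_in u. \<forall>L \<in> bodies_in u. \<forall>K' \<in> bodies_in u'. \<forall>L' \<in> bodies_in u'.
     slopes u y K = slopes u' y' K' \<longrightarrow> slopes u y L = slopes u' y' L' \<longrightarrow>
     slopes u y (g K L) = slopes u' y' (g K' L'))"

lemma compatible_sym: "compatible u y u' y' \<Longrightarrow> compatible u' y' u y"
  unfolding compatible_def by metis

text \<open>With \<open>e0, e1\<close> dual to \<open>u, y\<close>, the point
  \<open>e0 + t *\<^sub>R e1\<close> has slope \<open>t\<close>, so every compact interval is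
  realised by an arc.\<close>

lemma exists_body_slopes:
  assumes "u \<bullet> e0 = 1" "y \<bullet> e0 = 0" "u \<bullet> e1 = 0" "y \<bullet> e1 = 1"
  shows "arc (e0 + a *\<^sub>R e1) (e0 + b *\<^sub>R e1) \<in> bodies_in u"
    and "slopes u y (arc (e0 + a *\<^sub>R e1) (e0 + b *\<^sub>R e1)) = closed_segment a b"
proof -
  have "u \<bullet> (e0 + t *\<^sub>R e1) = 1" "y \<bullet> (e0 + t *\<^sub>R e1) = t" for t
    using assms by (simp_all add: inner_add_right)
  then show "arc (e0 + a *\<^sub>R e1) (e0 + b *\<^sub>R e1) \<in> bodies_in u"
    "slopes u y (arc (e0 + a *\<^sub>R e1) (e0 + b *\<^sub>R e1)) = closed_segment a b"
    by (simp_all add: arc_bodies_in slopes_arc)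
qed

text \<open>Independence of \<open>v\<close> and \<open>z\<close> provides arcs whose slopes for the
  intermediate pair are those of \<open>K\<close> and \<open>L\<close>.\<close>

lemma compatible_trans:
  assumes "compatible u y v z" "compatible v z u' y'" and v: "v \<noteq> 0" "z \<notin> span {v}"
  shows "compatible u y u' y'"
  unfolding compatible_def
proof (intro ballI impI)
  fix K L K' L'
  assume K: "K \<in> bodies_in u" and L: "L \<in> bodies_in u" and K': "K' \<in> bodies_in u'" and L': "L' \<in> bodies_in u'"
    and eq: "slopes u y K = slopes u' y' K'" "slopes u y L = slopes u' y' L'"
  \<comment> \<open>\<open>w\<close> merely completes \<open>v, z\<close> to an independent
    triple.\<close>
  obtain w where w: "w \<notin> span {v, z}" using exists_outside_planes[OF dim3] by metis
  obtain e0 where e0: "v \<bullet> e0 = 1" "z \<bullet> e0 = 0" using exists_inner_eq3[OF v w] by metis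
  obtain e1 where e1: "v \<bullet> e1 = 0" "z \<bullet> e1 = 1" using exists_inner_eq3[OF v w] by metis
  have "\<exists>M \<in> bodies_in v. slopes v z M = slopes u y N" if N: "N \<in> bodies_in u" for N
  proof -
    obtain a b where "slopes u y N = closed_segment a b"
      using slopes_body_interval[OF N] closed_segment_eq_real_ivl by metis
    then show ?thesis using exists_body_slopes[OF e0 e1] by metis
  qed
  then obtain M N where "M \<in> bodies_in v" "slopes v z M = slopes u y K"
    "N \<in> bodies_in v" "slopes v z N = slopes u y L" using K L by metis
  then show "slopes u y (g K L) = slopes u' y' (g K' L')"
    using assms(1,2) K L K' L' eq unfolding compatible_def by metis
qed

text \<open>On bodies in the plane spanned by \<open>e0\<close> and \<open>e1\<close> the two pairs define the same slopes.\<close>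

lemma compatible_common_plane:
  assumes y: "y \<notin> span {u}" and y': "y' \<notin> span {u'}"
    and e0: "u \<bullet> e0 = 1" "y \<bullet> e0 = 0" "u' \<bullet> e0 = 1" "y' \<bullet> e0 = 0"
    and e1: "u \<bullet> e1 = 0" "y \<bullet> e1 = 1" "u' \<bullet> e1 = 0" "y' \<bullet> e1 = 1"
  shows "compatible u y u' y'"
  unfolding compatible_def
proof (intro ballI impI)
  fix K L K' L'
  assume K: "K \<in> bodies_in u" and L: "L \<in> bodies_in u" and K': "K' \<in> bodies_in u'" and L': "L' \<in> bodies_in u'"
    and eq: "slopes u y K = slopes u' y' K'" "slopes u y L = slopes u' y' L'"
  obtain a b where ab: "slopes u y K = closed_segment a b"
    using slopes_body_interval[OF K] closed_segment_eq_real_ivl by metis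
  obtain c d where cd: "slopes u y L = closed_segment c d"
    using slopes_body_interval[OF L] closed_segment_eq_real_ivl by metis
  define A where "A a b = arc (e0 + a *\<^sub>R e1) (e0 + b *\<^sub>R e1)" for a b
  have A: "A a b \<in> bodies_in u" "slopes u y (A a b) = closed_segment a b"
     "A a b \<in> bodies_in u'" "slopes u' y' (A a b) = closed_segment a b" for a b
    unfolding A_def using exists_body_slopes[OF e0(1,2) e1(1,2)] exists_body_slopes[OF e0(3,4) e1(3,4)] by simp_all
  have plane: "v \<bullet> k = v' \<bullet> k" if "k \<in> A a b" "v \<bullet> e0 = v' \<bullet> e0" "v \<bullet> e1 = v' \<bullet> e1" for k a b v v'
    using that by (auto simp: A_def arc_def closed_segment_def sgn_div_norm inner_add_right)
  have uu: "u \<bullet> k = u' \<bullet> k" and yy: "y \<bullet> k = y' \<bullet> k" if "k \<in> A a b" for k a b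
    using plane[OF that, of u u'] plane[OF that, of y y'] e0 e1 by simp_all
  \<comment> \<open>Linear forms that agree on the two test arcs agree on the result of the
    operation.\<close>
  have "u \<bullet> m = u' \<bullet> m" "y \<bullet> m = y' \<bullet> m" if "m \<in> g (A a b) (A c d)" for m
    using eq_op[OF A(1) A(1) _ that] uu yy by blast+
  then have "slopes u y (g (A a b) (A c d)) = slopes u' y' (g (A a b) (A c d))"
    unfolding slopes_def by (intro image_cong) auto
  moreover have "slopes u y (g K L) = slopes u y (g (A a b) (A c d))"
    using slopes_cong[OF y K A(1) L A(1)] ab cd A by simp
  moreover have "slopes u' y' (g K' L') = slopes u' y' (g (A a b) (A c d))"
    using slopes_cong[OF y' K' A(3) L' A(3)] eq ab cd A by simp
  ultimately show "slopes u y (g K L) = slopes u' y' (g K' L')" by simp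
qed

text \<open>Independence of the three vectors yields \<open>e0, e1\<close> on which \<open>y\<close>
  and \<open>z\<close> take equal values.\<close>

lemma compatible_same_pole:
  assumes u: "u \<noteq> 0" and y: "y \<notin> span {u}" and z: "z \<notin> span {u, y}"
  shows "compatible u y u z"
proof -
  obtain e0 where "u \<bullet> e0 = 1" "y \<bullet> e0 = 0" "z \<bullet> e0 = 0" using exists_inner_eq3[OF u y z] by metis
  moreover obtain e1 where "u \<bullet> e1 = 0" "y \<bullet> e1 = 1" "z \<bullet> e1 = 1" using exists_inner_eq3[OF u y z] by metis
  moreover have "z \<notin> span {u}" using z span_mono[of "{u}" "{u, y}"] by auto
  ultimately show ?thesis using compatible_common_plane[OF y] by simp
qed

lemma compatible_change_pole:
  assumes u: "u \<noteq> 0" and u': "u' \<notin> span {u}" and z: "z \<notin> span {u, u'}"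
  shows "compatible u z u' z"
proof -
  obtain e0 where "u \<bullet> e0 = 1" "u' \<bullet> e0 = 1" "z \<bullet> e0 = 0" using exists_inner_eq3[OF u u' z] by metis
  moreover obtain e1 where "u \<bullet> e1 = 0" "u' \<bullet> e1 = 0" "z \<bullet> e1 = 1" using exists_inner_eq3[OF u u' z] by metis
  moreover have "z \<notin> span {u}" "z \<notin> span {u'}"
    using z span_mono[of "{u}" "{u, u'}"] span_mono[of "{u'}" "{u, u'}"] by auto
  ultimately show ?thesis using compatible_common_plane by simp
qed

text \<open>A direction \<open>z\<close> in general position links the pairs through
  \<open>(u, z)\<close> and \<open>(u', z)\<close>.\<close>

lemma compatible_independent_poles:
  assumes u: "u \<noteq> 0" "y \<notin> span {u}" and u': "u' \<noteq> 0" "y' \<notin> span {u'}" and i: "u' \<notin> span {u}"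
  shows "compatible u y u' y'"
proof -
  obtain z where z: "z \<notin> span {u, y}" "z \<notin> span {u', y'}" "z \<notin> span {u, u'}"
    using exists_outside_planes[OF dim3] by metis
  have zu: "z \<notin> span {u}" "z \<notin> span {u'}"
    using z span_mono[of "{u}" "{u, u'}"] span_mono[of "{u'}" "{u, u'}"] by auto
  have "compatible u y u' z"
    using compatible_trans[OF compatible_same_pole compatible_change_pole] u z i zu by metis
  moreover have "compatible u' z u' y'" using compatible_sym compatible_same_pole u' z by metis
  ultimately show ?thesis using compatible_trans u' zu by metis
qed

text \<open>Possibly dependent poles are joined through a third pole \<open>v\<close> independent of
  each.\<close>

lemma compatible_all:
  assumes u: "u \<noteq> 0" "y \<notin> span {u}" and u': "u' \<noteq> 0" "y' \<notin> span {u'}"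
  shows "compatible u y u' y'"
proof -
  obtain v where "v \<notin> span {u, y}" "v \<notin> span {u', y'}" using exists_outside_planes[OF dim3] by metis
  then have v: "v \<notin> span {u}" "v \<notin> span {u'}"
    using span_mono[of "{u}" "{u, y}"] span_mono[of "{u'}" "{u', y'}"] by auto
  then have v0: "v \<noteq> 0" by (auto simp: span_zero)
  obtain w where "w \<notin> span {v, v}" using exists_outside_planes[OF dim3] by metis
  then have w: "w \<notin> span {v}" by simp
  show ?thesis
    using compatible_trans compatible_independent_poles[OF u v0 w v(1)]
      compatible_sym[OF compatible_independent_poles[OF u' v0 w v(2)]] v0 w by metis
qed

text \<open>The choice does not depend on the witnesses, by \<open>compatible_all\<close>; on sets
  that are not slopes of bodies it is arbitrary.\<close>

definition \<Phi> :: "real set \<Rightarrow> real set \<Rightarrow> real set" where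
  "\<Phi> I J = (SOME X. \<exists>u y K L. u \<noteq> 0 \<and> y \<notin> span {u} \<and> K \<in> bodies_in u \<and> L \<in> bodies_in u \<and>
     slopes u y K = I \<and> slopes u y L = J \<and> X = slopes u y (g K L))"

lemma slopes_op:
  assumes y: "y \<notin> span {u}" and K: "K \<in> bodies_in u" and L: "L \<in> bodies_in u"
  shows "slopes u y (g K L) = \<Phi> (slopes u y K) (slopes u y L)"
proof -
  have u: "u \<noteq> 0" using bodies_inD(1,6)[OF K] by force
  show ?thesis
    unfolding \<Phi>_def
  proof (rule someI2)
    show "\<exists>u' y' K' L'. u' \<noteq> 0 \<and> y' \<notin> span {u'} \<and> K' \<in> bodies_in u' \<and> L' \<in> bodies_in u' \<and>
     slopes u' y' K' = slopes u y K \<and> slopes u' y' L' = slopes u y L \<and> slopes u y (g K L) = slopes u' y' (g K' L')"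
      using y K L u by metis
  next
    fix X
    assume "\<exists>u' y' K' L'. u' \<noteq> 0 \<and> y' \<notin> span {u'} \<and> K' \<in> bodies_in u' \<and> L' \<in> bodies_in u' \<and>
     slopes u' y' K' = slopes u y K \<and> slopes u' y' L' = slopes u y L \<and> X = slopes u' y' (g K' L')"
    then show "slopes u y (g K L) = X"
      using compatible_all[OF u y] K L unfolding compatible_def by metis
  qed
qed

text \<open>Linear changes of pole and direction within a plane act on slopes by projective maps,
  half-spaces give the bounds, and a third dimension allows two slopes to be prescribed separately
  and added.\<close>

lemma interval_operation: "interval_operation \<Phi>"
proof -
  obtain T :: "'a set" where T: "T \<subseteq> Basis" "card T = 3"
    using obtain_subset_with_card_n[OF dim3] by metis
  then obtain b0 b1 b2 where b: "b0 \<in> Basis" "b1 \<in> Basis" "b2 \<in> Basis"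
    and "b0 \<noteq> b1" "b0 \<noteq> b2" "b1 \<noteq> (b2::'a)" by (auto simp: card_3_iff)
  then have o [simp]: "b0 \<bullet> b0 = 1" "b1 \<bullet> b1 = 1" "b2 \<bullet> b2 = 1" "b0 \<bullet> b1 = 0" "b1 \<bullet> b0 = 0"
      "b0 \<bullet> b2 = 0" "b2 \<bullet> b0 = 0" "b1 \<bullet> b2 = 0" "b2 \<bullet> b1 = 0"
    by (auto simp: inner_Basis)
  have ind: "y \<notin> span {b0}" if "b1 \<bullet> y \<noteq> 0 \<or> b2 \<bullet> y \<noteq> 0" for y
    using that by (auto simp: span_singleton)
  define A where "A a b = arc (b0 + a *\<^sub>R b1) (b0 + b *\<^sub>R b1)" for a b
  have A: "A a b \<in> bodies_in b0" "slopes b0 b1 (A a b) = closed_segment a b" for a b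
    unfolding A_def using exists_body_slopes[of b0 b0 b1 b1] by simp_all
  have \<Phi>_A: "\<Phi> (closed_segment a b) (closed_segment c d) = slopes b0 b1 (g (A a b) (A c d))" for a b c d
    using slopes_op[OF ind A(1) A(1), of b1 a b c d] by (simp add: A(2))
  have gA: "g (A a b) (A c d) \<in> bodies_in b0" for a b c d by (intro closed_op A)
  show ?thesis
  proof
    fix a b c d
    show "\<exists>p q. p \<le> q \<and> \<Phi> (closed_segment a b) (closed_segment c d) = {p..q}"
      unfolding \<Phi>_A using slopes_body_interval[OF gA] by metis
  next
    fix \<alpha> \<delta> \<beta> \<gamma> a b c d :: real
    assume nd: "\<alpha> * \<delta> - \<beta> * \<gamma> \<noteq> 0"
      and pos: "\<And>t. t \<in> closed_segment a b \<union> closed_segment c d \<Longrightarrow> \<alpha> + \<beta> * t > 0"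
    \<comment> \<open>The coefficients are those of the projective map; its nonzero determinant
      makes pole and direction independent.\<close>
    let ?u = "\<alpha> *\<^sub>R b0 + \<beta> *\<^sub>R b1" and ?y = "\<gamma> *\<^sub>R b0 + \<delta> *\<^sub>R b1"
    let ?h = "\<lambda>t. (\<gamma> + \<delta> * t) / (\<alpha> + \<beta> * t)"
    have sl: "slopes ?u ?y M = ?h ` slopes b0 b1 M" if "M \<in> bodies_in b0" for M
    proof -
      have "(?y \<bullet> k) / (?u \<bullet> k) = ?h ((b1 \<bullet> k) / (b0 \<bullet> k))" if "k \<in> M" for k
      proof -
        have k: "b0 \<bullet> k > 0" using bodies_inD(6)[OF \<open>M \<in> bodies_in b0\<close> that] .
        then have "?y \<bullet> k = (\<gamma> + \<delta> * ((b1 \<bullet> k) / (b0 \<bullet> k))) * (b0 \<bullet> k)"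
          "?u \<bullet> k = (\<alpha> + \<beta> * ((b1 \<bullet> k) / (b0 \<bullet> k))) * (b0 \<bullet> k)"
          by (simp_all add: inner_add_left field_simps)
        then show ?thesis using k by simp
      qed
      then show ?thesis unfolding slopes_def image_image by (intro image_cong refl) simp
    qed
    have "?u \<bullet> (b0 + t *\<^sub>R b1) = \<alpha> + \<beta> * t" for t by (simp add: inner_add_left inner_add_right)
    then have Au: "A a b \<in> bodies_in ?u" "A c d \<in> bodies_in ?u"
      unfolding A_def by (intro arc_bodies_in; use pos in simp)+
    have yu: "?y \<notin> span {?u}"
    proof
      assume "?y \<in> span {?u}"
      then obtain s where s: "?y = s *\<^sub>R ?u" by (auto simp: span_singleton)
      have "b0 \<bullet> ?y = b0 \<bullet> (s *\<^sub>R ?u)" "b1 \<bullet> ?y = b1 \<bullet> (s *\<^sub>R ?u)" unfolding s by simp_all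
      then have "\<gamma> = s * \<alpha>" "\<delta> = s * \<beta>" by (simp_all add: inner_add_right)
      then show False using nd by simp
    qed
    show "\<Phi> (?h ` closed_segment a b) (?h ` closed_segment c d) =
      ?h ` \<Phi> (closed_segment a b) (closed_segment c d)"
      using slopes_op[OF yu Au] sl[OF gA, of a b c d] sl[OF A(1)] by (simp add: A(2) \<Phi>_A)
  next
    fix a b c d s :: real
    assume s: "closed_segment a b \<subseteq> {s..}" "closed_segment c d \<subseteq> {s..}"
    \<comment> \<open>A slope bound becomes a closed half-space condition, to which
      \<open>nonneg_op\<close> applies.\<close>
    have key: "(b1 - s *\<^sub>R b0) \<bullet> m \<ge> 0 \<longleftrightarrow> (b1 \<bullet> m) / (b0 \<bullet> m) \<ge> s" if "M \<in> bodies_in b0" "m \<in> M" for m M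
      using bodies_inD(6)[OF that] by (simp add: inner_diff_left field_simps)
    have "(b1 - s *\<^sub>R b0) \<bullet> k \<ge> 0" if "k \<in> A a b \<union> A c d" for k
    proof -
      have "(b1 \<bullet> k) / (b0 \<bullet> k) \<in> slopes b0 b1 (A a b) \<union> slopes b0 b1 (A c d)"
        using that by (auto simp: slopes_def)
      then show ?thesis using key[OF A(1)] that s by (auto simp: A(2))
    qed
    from nonneg_op[OF A(1) A(1) this]
    have "(b1 \<bullet> m) / (b0 \<bullet> m) \<ge> s" if "m \<in> g (A a b) (A c d)" for m
      using that key[OF gA that] by blast
    then show "\<Phi> (closed_segment a b) (closed_segment c d) \<subseteq> {s..}"
      unfolding \<Phi>_A by (auto simp: slopes_def)
  next
    fix z a1 a2 p1 p2 c1 c2 d1 d2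
    assume z: "z \<in> \<Phi> (closed_segment (a1 + a2) (p1 + p2)) (closed_segment (c1 + c2) (d1 + d2))"
    \<comment> \<open>\<open>P s t\<close> has gnomonic coordinates \<open>(s, t)\<close>; the
      directions \<open>b1\<close>, \<open>b2\<close> and \<open>b1 + b2\<close> read off the
      coordinates and their sum.\<close>
    define P where "P s t = b0 + s *\<^sub>R b1 + t *\<^sub>R b2" for s t
    have P: "b0 \<bullet> P s t = 1" "b1 \<bullet> P s t = s" "b2 \<bullet> P s t = t" for s t
      by (simp_all add: P_def inner_add_right)
    let ?K = "arc (P a1 a2) (P p1 p2)" and ?L = "arc (P c1 c2) (P d1 d2)"
    have KL: "?K \<in> bodies_in b0" "?L \<in> bodies_in b0" by (intro arc_bodies_in; simp add: P)+
    have "z \<in> slopes b0 (b1 + b2) (g ?K ?L)"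
      using z slopes_op[OF ind KL, of "b1 + b2"] by (simp add: slopes_arc P inner_add_left inner_add_right)
    then obtain m where m: "m \<in> g ?K ?L" "z = (b1 \<bullet> m) / (b0 \<bullet> m) + (b2 \<bullet> m) / (b0 \<bullet> m)"
      by (auto simp: slopes_def inner_add_left add_divide_distrib)
    have "(b1 \<bullet> m) / (b0 \<bullet> m) \<in> \<Phi> (closed_segment a1 p1) (closed_segment c1 d1)"
      using m(1) slopes_op[OF ind KL, of b1] by (simp add: slopes_arc P) (force simp: slopes_def)
    moreover have "(b2 \<bullet> m) / (b0 \<bullet> m) \<in> \<Phi> (closed_segment a2 p2) (closed_segment c2 d2)"
      using m(1) slopes_op[OF ind KL, of b2] by (simp add: slopes_arc P) (force simp: slopes_def)
    ultimately show "\<exists>z1 \<in> \<Phi> (closed_segment a1 p1) (closed_segment c1 d1).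
      \<exists>z2 \<in> \<Phi> (closed_segment a2 p2) (closed_segment c2 d2). z = z1 + z2"
      using m(2) by blast
  qed
qed

theorem trichotomy:
  "(\<forall>u. \<forall>K \<in> bodies_in u. \<forall>L \<in> bodies_in u. g K L = K) \<or>
   (\<forall>u. \<forall>K \<in> bodies_in u. \<forall>L \<in> bodies_in u. g K L = L) \<or>
   (\<forall>u. \<forall>K \<in> bodies_in u. \<forall>L \<in> bodies_in u. g K L = sconv (K \<union> L))"
proof -
  interpret interval_operation \<Phi> by (rule interval_operation)
  \<comment> \<open>A body is determined by its slopes, so only the slopes of the candidate
    \<open>N\<close> have to be compared with \<open>\<Phi>\<close>.\<close>
  have det: "g K L = N"
    if K: "K \<in> bodies_in u" and L: "L \<in> bodies_in u" and N: "N \<in> bodies_in u"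
      and eq: "\<And>y a b c d. slopes u y K = {a..b} \<Longrightarrow> slopes u y L = {c..d} \<Longrightarrow> a \<le> b \<Longrightarrow> c \<le> d \<Longrightarrow>
        slopes u y N = \<Phi> {a..b} {c..d}" for u K L N
  proof -
    have "u \<noteq> 0" using bodies_inD(1,6)[OF K] by force
    moreover have "slopes u y (g K L) = slopes u y N" if "y \<notin> span {u}" for y
      using slopes_op[OF that K L] eq slopes_body_interval[OF K, of y] slopes_body_interval[OF L, of y] by metis
    ultimately show ?thesis
      using bodies_subset_by_slopes[OF closed_op[OF K L] N] bodies_subset_by_slopes[OF N closed_op[OF K L]] by blast
  qed
  show ?thesis
    using classification
  proof (elim disjE)
    assume "\<forall>a b c d. a \<le> b \<longrightarrow> c \<le> d \<longrightarrow> \<Phi> {a..b} {c..d} = {a..b}"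
    then show ?thesis by (intro disjI1 allI ballI det) auto
  next
    assume "\<forall>a b c d. a \<le> b \<longrightarrow> c \<le> d \<longrightarrow> \<Phi> {a..b} {c..d} = {c..d}"
    then show ?thesis by (intro disjI2[OF disjI1] allI ballI det) auto
  next
    assume "\<forall>a b c d. a \<le> b \<longrightarrow> c \<le> d \<longrightarrow> \<Phi> {a..b} {c..d} = {min a c..max b d}"
    then show ?thesis
      by (intro disjI2[OF disjI2] allI ballI det sconv_bodies(2)) (auto simp: slopes_sconv)
  qed
qed

end

subsection \<open>Projection covariance\<close>

lemma linear_closest_point_subspace:
  fixes V :: "'a::euclidean_space set"
  assumes V: "subspace V"
  shows "linear (closest_point V)"
proof (rule linearI)
  have mem: "closest_point V x \<in> V" for x
    using V subspace_0[OF V] by (intro closest_point_in_set) (auto simp: closed_subspace)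
  have ort: "(x - closest_point V x) \<bullet> v = 0" if "v \<in> V" for x v
    using closest_point_subspace_orthogonal[OF V that] .
  fix x y :: 'a and c :: real
  show "closest_point V (x + y) = closest_point V x + closest_point V y"
    using mem ort[of _ x] ort[of _ y]
    by (intro closest_point_subspace_eqI[OF V] subspace_add[OF V]) (auto simp: inner_diff_left inner_add_left)
  show "closest_point V (c *\<^sub>R x) = c *\<^sub>R closest_point V x"
    using mem ort[of _ x]
    by (intro closest_point_subspace_eqI[OF V] subspace_scale[OF V]) (auto simp: inner_diff_left)
qed

lemma inner_closest_point_subspace:
  fixes V :: "'a::euclidean_space set"
  assumes "subspace V" "v \<in> V"
  shows "v \<bullet> closest_point V x = v \<bullet> x"
  using closest_point_subspace_orthogonal[OF assms, of x]
  by (simp add: inner_diff_left inner_commute[of v])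

lemma compact_linear_image_euclidean:
  fixes P :: "'a::euclidean_space \<Rightarrow> 'a"
  assumes "linear P" "compact X"
  shows "compact (P ` X)"
  using assms by (intro compact_continuous_image linear_continuous_on)
    (simp_all add: linear_conv_bounded_linear)

lemma sgn_linear_sgn:
  fixes P :: "'a::euclidean_space \<Rightarrow> 'a"
  assumes "linear P"
  shows "sgn (P (sgn x)) = sgn (P x)"
  by (cases "x = 0") (simp_all add: sgn_div_norm[of x] linear_scale[OF assms] linear_0[OF assms] sgn_scaleR)

text \<open>Nonvanishing of \<open>u \<bullet> m\<close> keeps the projected points away from
  \<open>0\<close>. Either sign is allowed, so that reflected bodies are covered.\<close>

lemma sphere_proj_eq_sgn_image:
  fixes V :: "'a::euclidean_space set"
  assumes V: "subspace V" and u: "u \<in> V" and M: "spherical_convex M" and nz: "\<And>m. m \<in> M \<Longrightarrow> u \<bullet> m \<noteq> 0"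
  shows "sphere_proj M (V \<inter> sphere 0 1) = sgn ` closest_point V ` M"
proof -
  let ?P = "closest_point V"
  note lin = linear_closest_point_subspace[OF V]
  have "?P ` rad M \<inter> sphere 0 1 = sgn ` ?P ` M"
  proof (intro equalityI subsetI)
    fix x assume "x \<in> ?P ` rad M \<inter> sphere 0 1"
    then obtain l m where x: "x = l *\<^sub>R ?P m" "0 \<le> l" "m \<in> M" "norm x = 1"
      by (auto simp: rad_def linear_scale[OF lin])
    then have "l > 0" by (cases "l = 0") auto
    then have "sgn (?P m) = sgn x" using x(1) by (simp add: sgn_scaleR)
    also have "\<dots> = x" using x(4) by (simp add: sgn_div_norm)
    finally show "x \<in> sgn ` ?P ` M" using x(3) by force
  next
    fix x assume "x \<in> sgn ` ?P ` M"
    then obtain m where m: "m \<in> M" "x = sgn (?P m)" by auto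
    have "u \<bullet> ?P m \<noteq> 0" using nz[OF m(1)] inner_closest_point_subspace[OF V u] by simp
    then have "?P m \<noteq> 0" by auto
    then have "x \<in> sphere 0 1" by (simp add: m(2) norm_sgn)
    moreover have "x = ?P (inverse (norm (?P m)) *\<^sub>R m)"
      by (simp add: m(2) sgn_div_norm linear_scale[OF lin])
    ultimately show "x \<in> ?P ` rad M \<inter> sphere 0 1"
      using m(1) by (auto intro!: imageI radI)
  qed
  then show ?thesis using sphere_proj_eq_orthogonal_projection[OF V M] by simp
qed

lemma sphere_proj_body:
  assumes V: "subspace V" and u: "u \<in> V" and K: "K \<in> bodies_in u"
  shows "sphere_proj K (V \<inter> sphere 0 1) = sgn ` closest_point V ` K"
  using sphere_proj_eq_sgn_image[OF V u bodies_inD(4)[OF K]] bodies_inD(6)[OF K] by force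

text \<open>Normalising before the linear projection does not affect the final direction, so
  \<open>K\<close> may be replaced by its Euclidean hull, whose linear image is compact and
  convex.\<close>

lemma sphere_proj_bodies_in:
  assumes V: "subspace V" and u: "u \<in> V" and K: "K \<in> bodies_in u"
  shows "sphere_proj K (V \<inter> sphere 0 1) \<in> bodies_in u"
proof -
  let ?P = "closest_point V" and ?C = "convex hull K"
  note lin = linear_closest_point_subspace[OF V]
  have "?C \<subseteq> {x. u \<bullet> x > 0}"
    using bodies_inD[OF K] by (intro hull_minimal) (auto simp: convex_halfspace_gt)
  then have "sgn ` ?P ` ?C \<in> bodies_in u"
    using bodies_inD[OF K] inner_closest_point_subspace[OF V u]
    by (intro sgn_image_bodies_in compact_linear_image_euclidean convex_linear_image lin compact_convex_hull) auto
  also have "sgn ` ?P ` ?C = sgn ` ?P ` sgn ` ?C"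
    unfolding image_image by (simp add: sgn_linear_sgn[OF lin])
  also have "\<dots> = sphere_proj K (V \<inter> sphere 0 1)"
    using body_eq_sgn_convex_hull[OF K] sphere_proj_body[OF V u K] by simp
  finally show ?thesis .
qed

text \<open>Euclidean hulls commute with linear maps, and intermediate normalisations are absorbed
  by the last one.\<close>

lemma sphere_proj_sconv:
  assumes V: "subspace V" and u: "u \<in> V" and K: "K \<in> bodies_in u" and L: "L \<in> bodies_in u"
  defines "S \<equiv> V \<inter> sphere 0 1"
  shows "sphere_proj (sconv (K \<union> L)) S = sconv (sphere_proj K S \<union> sphere_proj L S)"
proof -
  let ?P = "closest_point V"
  note lin = linear_closest_point_subspace[OF V]
  have "sconv (sphere_proj K S \<union> sphere_proj L S) = sconv (sgn ` (?P ` (K \<union> L)))"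
    by (simp add: S_def sphere_proj_body[OF V u] K L image_Un)
  also have "\<dots> = sgn ` (convex hull (?P ` (K \<union> L)))"
    using bodies_inD[OF K] bodies_inD[OF L] inner_closest_point_subspace[OF V u]
    by (intro sconv_sgn_image[of _ u] compact_linear_image_euclidean compact_Un lin) auto
  also have "\<dots> = sgn ` ?P ` (convex hull (K \<union> L))"
    by (simp only: convex_hull_linear_image[OF lin])
  also have "\<dots> = sgn ` ?P ` sgn ` (convex hull (K \<union> L))"
    unfolding image_image by (simp add: sgn_linear_sgn[OF lin])
  also have "\<dots> = sphere_proj (sconv (K \<union> L)) S"
    using sphere_proj_body[OF V u sconv_bodies(2)[OF K L]] sconv_bodies(1)[OF K L] by (simp add: S_def)
  finally show ?thesis by simp
qed

lemma body_pairsI: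
  assumes "K \<in> bodies_in u" "L \<in> bodies_in u"
  shows "(K, L) \<in> body_pairs"
proof -
  have "u \<noteq> 0" using bodies_inD(1,6)[OF assms(1)] by force
  then have "sgn u \<in> sphere 0 1" by (simp add: norm_sgn)
  then show ?thesis using assms bodies_in_sgn[of u] unfolding body_pairs_def by blast
qed

lemma body_pairsE:
  assumes "(K, L) \<in> body_pairs"
  obtains u where "u \<in> sphere 0 1" "K \<in> bodies_in u" "L \<in> bodies_in u"
  using assms by (auto simp: body_pairs_def)

lemma singleton_bodies_in: "norm x = 1 \<Longrightarrow> u \<bullet> x > 0 \<Longrightarrow> {x} \<in> bodies_in u"
  using arc_bodies_in[of u x x] by (simp add: arc_def sgn_div_norm)

lemma rad_scaleR_image:
  fixes M :: "'a::euclidean_space set"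
  shows "rad ((*\<^sub>R) s ` M) = (*\<^sub>R) s ` rad M"
proof -
  have "rad A = (\<Union>l\<in>{0..}. (*\<^sub>R) l ` A)" for A :: "'a set" by (auto simp: rad_def)
  then show ?thesis by (simp add: image_UN image_image mult.commute)
qed

lemma convex_body_scaleR_image:
  assumes "convex_body M" "\<bar>s\<bar> = 1"
  shows "convex_body ((*\<^sub>R) s ` M)"
  using assms closed_scaling[of M s] convex_scaling[of "rad M" s]
  by (auto simp: convex_body_def spherical_convex_def rad_scaleR_image)

lemma slopes_scaleR_image: "s \<noteq> 0 \<Longrightarrow> slopes u y ((*\<^sub>R) s ` M) = slopes u y M"
  by (simp add: slopes_def image_image)

lemma sphere_proj_scaleR_image:
  assumes V: "subspace V" and u: "u \<in> V" and M: "M \<in> bodies_in u" and s: "\<bar>s\<bar> = 1"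
  shows "sphere_proj ((*\<^sub>R) s ` M) (V \<inter> sphere 0 1) = (*\<^sub>R) s ` sphere_proj M (V \<inter> sphere 0 1)"
proof -
  have "sphere_proj ((*\<^sub>R) s ` M) (V \<inter> sphere 0 1) = sgn ` closest_point V ` ((*\<^sub>R) s ` M)"
    using convex_body_scaleR_image[OF bodies_in_convex_body[OF M] s] bodies_inD(6)[OF M] s
    by (intro sphere_proj_eq_sgn_image[OF V u]) (force simp: convex_body_def)+
  also have "\<dots> = (*\<^sub>R) s ` sgn ` closest_point V ` M"
    using s by (auto simp: image_image linear_scale[OF linear_closest_point_subspace[OF V]] sgn_scaleR abs_if split: if_splits)
  finally show ?thesis by (simp add: sphere_proj_body[OF V u M])
qed

section \<open>The two hull operations are covariant and non-trivial\<close>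

text \<open>The scalar \<open>s\<close> treats the hull and its antipode at once; hull and scaling
  both commute with the projection.\<close>

lemma projection_covariant_sconv:
  assumes s: "\<bar>s\<bar> = 1" and f: "\<And>K L. (K, L) \<in> body_pairs \<Longrightarrow> f K L = (*\<^sub>R) s ` sconv (K \<union> L)"
  shows "projection_covariant f"
  unfolding projection_covariant_def
proof (intro ballI allI impI)
  fix u :: 'a and k :: nat and S K L
  assume S: "k + 2 \<le> DIM('a) \<and> k_sphere k S \<and> u \<in> S" and K: "K \<in> bodies_in u" and L: "L \<in> bodies_in u"
  then obtain V where V: "subspace V" "u \<in> V" "S = V \<inter> sphere 0 1" by (auto simp: k_sphere_def)
  have "(sphere_proj K S, sphere_proj L S) \<in> body_pairs"
    using sphere_proj_bodies_in[OF V(1,2)] K L V(3) body_pairsI by metis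
  then show "f (sphere_proj K S) (sphere_proj L S) = sphere_proj (f K L) S"
    using sphere_proj_sconv[OF V(1,2) K L] sphere_proj_scaleR_image[OF V(1,2) sconv_bodies(2)[OF K L] s]
      f body_pairsI[OF K L] V(3) by simp
qed

text \<open>For two distinct basis vectors the hull has at least two points, whereas a trivial
  operation returns a singleton.\<close>

lemma nontrivial_sconv:
  fixes f :: "'a::euclidean_space set \<Rightarrow> 'a set \<Rightarrow> 'a set"
  assumes dim: "2 \<le> DIM('a)" and s: "\<bar>s\<bar> = 1"
    and f: "\<And>K L. (K, L) \<in> body_pairs \<Longrightarrow> f K L = (*\<^sub>R) s ` sconv (K \<union> L)"
  shows "\<not> trivial_operation f"
proof
  assume triv: "trivial_operation f"
  obtain T :: "'a set" where T: "T \<subseteq> Basis" "card T = 2"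
    using obtain_subset_with_card_n[OF dim] by metis
  then obtain a b :: 'a where b: "a \<in> Basis" "b \<in> Basis" "a \<noteq> b" by (auto simp: card_2_iff)
  then have "{a} \<in> bodies_in (a + b)" "{b} \<in> bodies_in (a + b)"
    by (auto intro!: singleton_bodies_in simp: inner_add_left inner_Basis)
  then have ab: "({a}, {b}) \<in> body_pairs" by (rule body_pairsI)
  have "{a, b} \<subseteq> sconv ({a} \<union> {b})" using hull_subset[of "{a} \<union> {b}" spherical_convex] by simp
  then have "s *\<^sub>R a \<in> f {a} {b}" "s *\<^sub>R b \<in> f {a} {b}" using f[OF ab] by auto
  moreover have "s *\<^sub>R a \<noteq> s *\<^sub>R b" using s b by auto
  moreover have "f {a} {b} \<in> {{a}, {- a}, {b}, {- b}}"
    using triv ab by (auto simp: trivial_operation_def)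
  then obtain c where "f {a} {b} = {c}" by blast
  ultimately show False by (metis singletonD)
qed

section \<open>The sign of a covariant operation\<close>

text \<open>Every body in the hemisphere of \<open>u\<close> projects to \<open>{u}\<close> on the
  0-sphere \<open>{u, - u}\<close>, so all results \<open>f K L\<close> share the projection
  \<open>f {u} {u}\<close>, which is nonempty and proper, hence one of the two points. Points
  orthogonal to \<open>u\<close> project to \<open>0\<close> and leave no trace; this is why the
  inequality is weak.\<close>

lemma pole_values:
  fixes f :: "'a::euclidean_space set \<Rightarrow> 'a set \<Rightarrow> 'a set"
  assumes dim: "2 \<le> DIM('a)" and cov: "projection_covariant f"
    and proper: "\<And>K L. (K, L) \<in> body_pairs \<Longrightarrow> f K L \<in> proper_bodies"
    and u: "norm u = 1"
  obtains s where "s = 1 \<or> s = -1" "s *\<^sub>R u \<in> f {u} {u}"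
    "\<And>K L m. K \<in> bodies_in u \<Longrightarrow> L \<in> bodies_in u \<Longrightarrow> m \<in> f K L \<Longrightarrow> s * (u \<bullet> m) \<ge> 0"
proof -
  let ?V = "span {u}" and ?S = "span {u} \<inter> sphere 0 1"
  have V: "subspace ?V" "u \<in> ?V" by (auto simp: span_base)
  have u0: "u \<noteq> 0" using u by auto
  have "dim {u} = 1" using u0 by (simp add: dim_eq_card_independent)
  then have S: "0 + 2 \<le> DIM('a) \<and> k_sphere 0 ?S \<and> u \<in> ?S"
    using dim u V by (auto simp: k_sphere_def intro!: exI[of _ ?V])
  have P: "closest_point ?V x = (u \<bullet> x) *\<^sub>R u" for x
  proof (rule closest_point_subspace_eqI[OF V(1)])
    have uu: "u \<bullet> u = 1" using u by (simp add: dot_square_norm)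
    show "(x - (u \<bullet> x) *\<^sub>R u) \<bullet> v = 0" if v: "v \<in> ?V" for v
    proof -
      obtain k where "v = k *\<^sub>R u" using v by (auto simp: span_singleton)
      then show ?thesis using uu by (simp add: inner_diff_left inner_commute[of x])
    qed
  qed (use V in \<open>auto intro: span_scale\<close>)
  have pu: "sphere_proj K ?S = {u}" if K: "K \<in> bodies_in u" for K
  proof -
    have "sgn (closest_point ?V k) = u" if "k \<in> K" for k
      using bodies_inD(6)[OF K that] u by (simp add: P sgn_scaleR sgn_div_norm)
    then show ?thesis using bodies_inD(1)[OF K] by (auto simp: sphere_proj_body[OF V K] image_image)
  qed
  have eq: "f {u} {u} = sphere_proj (f K L) ?S" if "K \<in> bodies_in u" "L \<in> bodies_in u" for K L
  proof -
    have "u \<in> sphere 0 1" using u by simp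
    then have "f (sphere_proj K ?S) (sphere_proj L ?S) = sphere_proj (f K L) ?S"
      using cov S that unfolding projection_covariant_def by blast
    then show ?thesis using pu that by simp
  qed
  have uu: "{u} \<in> bodies_in u" using u u0 by (intro singleton_bodies_in) auto
  obtain w where w: "f {u} {u} \<noteq> {}" "f {u} {u} \<subseteq> open_hemisphere w"
    using proper[OF body_pairsI[OF uu uu]] by (auto simp: proper_bodies_def convex_body_def)
  have sub: "f {u} {u} \<subseteq> ?S" using eq[OF uu uu] by (auto simp: sphere_proj_def)
  obtain x where x: "x \<in> f {u} {u}" using w by auto
  then have "x \<in> ?S" using sub by blast
  then obtain s where s: "x = s *\<^sub>R u" "norm x = 1" unfolding span_singleton by fastforce
  then have s1: "s = 1 \<or> s = -1" using u by auto
  moreover have "s * (u \<bullet> m) \<ge> 0" if K: "K \<in> bodies_in u" and L: "L \<in> bodies_in u" and m: "m \<in> f K L" for K L m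
  proof (cases "u \<bullet> m = 0")
    case False
    have sc: "spherical_convex (f K L)"
      using proper[OF body_pairsI[OF K L]] by (auto simp: proper_bodies_def convex_body_def)
    \<comment> \<open>The factor makes the projection of \<open>m\<close> to the line a unit
      vector.\<close>
    have "inverse \<bar>u \<bullet> m\<bar> *\<^sub>R m \<in> rad (f K L)" using m by (intro radI) auto
    then have "closest_point ?V (inverse \<bar>u \<bullet> m\<bar> *\<^sub>R m) \<in> closest_point ?V ` rad (f K L)" by (rule imageI)
    moreover have "closest_point ?V (inverse \<bar>u \<bullet> m\<bar> *\<^sub>R m) = sgn (u \<bullet> m) *\<^sub>R u"
      unfolding P by (simp add: sgn_div_norm divide_inverse mult.commute)
    moreover have "sgn (u \<bullet> m) *\<^sub>R u \<in> sphere 0 1" using u False by (simp add: sgn_if)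
    ultimately have "sgn (u \<bullet> m) *\<^sub>R u \<in> f {u} {u}"
      using eq[OF K L] sphere_proj_eq_orthogonal_projection[OF V(1) sc] by simp
    \<comment> \<open>The hemisphere with pole \<open>w\<close> cannot contain both \<open>u\<close>
      and \<open>- u\<close>.\<close>
    then have "w \<bullet> (sgn (u \<bullet> m) *\<^sub>R u) > 0" "w \<bullet> (s *\<^sub>R u) > 0"
      using w x s by (auto simp: open_hemisphere_def)
    then have "sgn (u \<bullet> m) * (w \<bullet> u) > 0" "s * (w \<bullet> u) > 0" by simp_all
    then show ?thesis using s1 by (auto simp: sgn_if split: if_splits)
  qed simp
  ultimately show ?thesis using that x s by blast
qed

text \<open>The sign agrees at poles with an acute angle, then at orthogonal ones, then at any two,
  since from dimension three on some vector is orthogonal to both. Strictness follows by tilting: a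
  boundary point would violate the weak inequality for a tilted pole.\<close>

lemma global_sign:
  fixes f :: "'a::euclidean_space set \<Rightarrow> 'a set \<Rightarrow> 'a set"
  assumes dim: "3 \<le> DIM('a)" and cov: "projection_covariant f"
    and proper: "\<And>K L. (K, L) \<in> body_pairs \<Longrightarrow> f K L \<in> proper_bodies"
  obtains s :: real where "\<bar>s\<bar> = 1"
    "\<And>u K L m. K \<in> bodies_in u \<Longrightarrow> L \<in> bodies_in u \<Longrightarrow> m \<in> f K L \<Longrightarrow> s * (u \<bullet> m) > 0"
proof -
  have "2 \<le> DIM('a)" using dim by simp
  note pole = pole_values[OF this cov proper]
  have "\<forall>u. \<exists>s. norm u = 1 \<longrightarrow> (s = 1 \<or> s = -1) \<and> s *\<^sub>R u \<in> f {u} {u} \<and>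
    (\<forall>K \<in> bodies_in u. \<forall>L \<in> bodies_in u. \<forall>m \<in> f K L. s * (u \<bullet> m) \<ge> 0)"
    using pole by metis
  then obtain \<sigma> :: "'a \<Rightarrow> real" where \<sigma>: "\<And>u. norm u = 1 \<Longrightarrow> \<sigma> u = 1 \<or> \<sigma> u = -1"
      "\<And>u. norm u = 1 \<Longrightarrow> \<sigma> u *\<^sub>R u \<in> f {u} {u}"
      "\<And>u K L m. norm u = 1 \<Longrightarrow> K \<in> bodies_in u \<Longrightarrow> L \<in> bodies_in u \<Longrightarrow> m \<in> f K L \<Longrightarrow> \<sigma> u * (u \<bullet> m) \<ge> 0"
    by metis
  have near: "\<sigma> u = \<sigma> w" if u: "norm u = 1" and w: "norm w = 1" and pos: "u \<bullet> w > 0" for u w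
  proof -
    have "{w} \<in> bodies_in u" using w pos by (rule singleton_bodies_in)
    then have "\<sigma> u * (u \<bullet> (\<sigma> w *\<^sub>R w)) \<ge> 0" using \<sigma>(3)[OF u] \<sigma>(2)[OF w] by blast
    then have "(\<sigma> u * \<sigma> w) * (u \<bullet> w) \<ge> 0" by (simp add: mult.assoc)
    then have "\<sigma> u * \<sigma> w \<ge> 0" using pos by (simp add: zero_le_mult_iff)
    then show ?thesis using \<sigma>(1)[OF u] \<sigma>(1)[OF w] by auto
  qed
  have orth: "\<sigma> u = \<sigma> z" if u: "norm u = 1" and z: "norm z = 1" and "u \<bullet> z = 0" for u z
  proof -
    \<comment> \<open>The bisector makes acute angles with both vectors.\<close>
    let ?w = "sgn (u + z)"
    have "u \<bullet> (u + z) = 1" "z \<bullet> (u + z) = 1"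
      using that by (simp_all add: inner_add_right dot_square_norm inner_commute)
    then have "u \<bullet> ?w > 0" "z \<bullet> ?w > 0" "u + z \<noteq> 0" by (auto simp: inner_sgn_pos_iff)
    then show ?thesis using near[OF u, of ?w] near[OF z, of ?w] by (simp add: norm_sgn)
  qed
  have const: "\<sigma> u = \<sigma> v" if u: "norm u = 1" and v: "norm v = 1" for u v
  proof -
    have "dim {u, v} \<le> card {u, v}" by (rule dim_le_card') simp
    also have "\<dots> \<le> 2" by (simp add: card_insert_if)
    finally have "dim {u, v} < DIM('a)" using dim by simp
    then obtain z where z: "z \<noteq> 0" "\<And>x. x \<in> span {u, v} \<Longrightarrow> orthogonal z x"
      using orthogonal_to_subspace_exists by metis
    have "orthogonal z u" "orthogonal z v" by (auto intro!: z(2) span_base)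
    then have "u \<bullet> sgn z = 0" "v \<bullet> sgn z = 0" by (auto simp: orthogonal_def sgn_div_norm inner_commute)
    then show ?thesis using orth[OF u, of "sgn z"] orth[OF v, of "sgn z"] z(1) by (simp add: norm_sgn)
  qed
  obtain u0 :: 'a where u0: "norm u0 = 1" using vector_choose_size[of 1] by auto
  define s where "s = \<sigma> u0"
  have s: "\<bar>s\<bar> = 1" "s * s = 1" using \<sigma>(1)[OF u0] by (auto simp: s_def)
  have ge: "s * (u \<bullet> m) \<ge> 0" if "u \<noteq> 0" "K \<in> bodies_in u" "L \<in> bodies_in u" "m \<in> f K L" for u K L m
  proof -
    have n: "norm (sgn u) = 1" using that(1) by (simp add: norm_sgn)
    have "s * (sgn u \<bullet> m) \<ge> 0"
      using \<sigma>(3)[OF n, of K L m] that const[OF u0 n] by (simp add: bodies_in_sgn s_def)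
    then have "(s * (u \<bullet> m)) / norm u \<ge> 0" by (simp add: sgn_div_norm divide_inverse ac_simps)
    then show ?thesis using that(1) by (simp add: zero_le_divide_iff)
  qed
  have "s * (u \<bullet> m) > 0" if K: "K \<in> bodies_in u" and L: "L \<in> bodies_in u" and m: "m \<in> f K L" for u K L m
  proof (rule ccontr)
    assume neg: "\<not> s * (u \<bullet> m) > 0"
    have m1: "norm m = 1"
      using proper[OF body_pairsI[OF K L]] m by (auto simp: proper_bodies_def convex_body_def spherical_convex_def)
    \<comment> \<open>Compactness gives a positive margin that leaves room for tilting.\<close>
    obtain e where e: "e > 0" "\<And>k. k \<in> K \<union> L \<Longrightarrow> u \<bullet> k \<ge> e"
    proof -
      have "compact (K \<union> L)" "K \<union> L \<noteq> {}" using bodies_inD[OF K] bodies_inD[OF L] by auto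
      moreover have "continuous_on (K \<union> L) (\<lambda>k. u \<bullet> k)" by (intro continuous_intros)
      ultimately obtain k0 where k0: "k0 \<in> K \<union> L" "\<And>k. k \<in> K \<union> L \<Longrightarrow> u \<bullet> k0 \<le> u \<bullet> k"
        using continuous_attains_inf[of "K \<union> L" "\<lambda>k. u \<bullet> k"] by blast
      have "u \<bullet> k0 > 0" using k0(1) bodies_inD(6)[OF K] bodies_inD(6)[OF L] by blast
      then show ?thesis using that k0(2) by blast
    qed
    \<comment> \<open>This tilt keeps \<open>K\<close> and \<open>L\<close> in the open half-space
      but lowers \<open>s * (u \<bullet> m)\<close> by \<open>e / 2\<close>.\<close>
    let ?v = "u - ((e / 2) * s) *\<^sub>R m"
    have v: "?v \<bullet> k > 0" if k: "k \<in> K \<union> L" for k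
    proof -
      have "norm k = 1" using k bodies_inD(7)[OF K] bodies_inD(7)[OF L] by auto
      then have "\<bar>m \<bullet> k\<bar> \<le> 1" using Cauchy_Schwarz_ineq2[of m k] m1 by simp
      then have "s * (m \<bullet> k) \<le> 1" using s(1) by (auto simp: abs_if split: if_splits)
      then have "(e / 2) * (s * (m \<bullet> k)) \<le> e / 2" using e(1) by simp
      moreover have "?v \<bullet> k = u \<bullet> k - (e / 2) * (s * (m \<bullet> k))" by (simp add: inner_diff_left)
      ultimately show ?thesis using e(2)[OF k] e(1) by linarith
    qed
    then have "K \<in> bodies_in ?v" "L \<in> bodies_in ?v"
      using bodies_in_change[OF K] bodies_in_change[OF L] by auto
    moreover have "?v \<noteq> 0" using v bodies_inD(1)[OF K] by (metis UnI1 all_not_in_conv inner_zero_left less_irrefl)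
    ultimately have "s * (?v \<bullet> m) \<ge> 0" using ge m by blast
    also have "s * (?v \<bullet> m) = s * (u \<bullet> m) - (e / 2) * (s * s)"
      using m1 by (simp add: inner_diff_left dot_square_norm algebra_simps)
    finally show False using neg e(1) s(2) by simp
  qed
  then show ?thesis using that s(1) by blast
qed

section \<open>Projections to great circles and slopes\<close>

text \<open>Within the span of \<open>u\<close> and \<open>y\<close>, a point with positive
  \<open>u\<close>-component is determined up to scaling by its slope.\<close>

lemma sphere_proj_mono_slopes:
  assumes K: "K \<in> bodies_in u" and K': "K' \<in> bodies_in u" and le: "slopes u y K \<subseteq> slopes u y K'"
  shows "sphere_proj K (span {u, y} \<inter> sphere 0 1) \<subseteq> sphere_proj K' (span {u, y} \<inter> sphere 0 1)"
proof -
  let ?V = "span {u, y}" and ?P = "closest_point (span {u, y})"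
  have V: "subspace ?V" "u \<in> ?V" "y \<in> ?V" by (auto simp: span_base)
  note lin = linear_closest_point_subspace[OF V(1)]
  have mem: "?P x \<in> ?V" for x
    using V by (intro closest_point_in_set) (auto simp: closed_subspace)
  have "sgn (?P k) \<in> sgn ` ?P ` K'" if k: "k \<in> K" for k
  proof -
    have "(y \<bullet> k) / (u \<bullet> k) \<in> slopes u y K'" using le k by (auto simp: slopes_def)
    then obtain k' where k': "k' \<in> K'" "(y \<bullet> k) / (u \<bullet> k) = (y \<bullet> k') / (u \<bullet> k')" by (auto simp: slopes_def)
    have pos: "u \<bullet> k > 0" "u \<bullet> k' > 0" using bodies_inD(6) K K' k k'(1) by auto
    \<comment> \<open>This factor equalises the inner products with \<open>u\<close>; equal slopes
      then equalise those with \<open>y\<close>, so the difference \<open>?w\<close> is orthogonal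
      to the span in which it lies.\<close>
    let ?c = "(u \<bullet> k') / (u \<bullet> k)"
    let ?w = "?P k' - ?c *\<^sub>R ?P k"
    have "u \<bullet> ?w = 0" "y \<bullet> ?w = 0" using pos k'(2)
      by (simp_all add: inner_diff_right inner_closest_point_subspace V field_simps)
    then have "orthogonal ?w x" if "x \<in> {u, y}" for x using that by (auto simp: orthogonal_def inner_commute)
    moreover have "?w \<in> ?V" by (intro subspace_diff subspace_scale mem V)
    ultimately have "orthogonal ?w ?w" using orthogonal_to_span by blast
    then have "?P k' = ?c *\<^sub>R ?P k" by (simp add: orthogonal_def)
    then have "sgn (?P k) = sgn (?P k')" using pos by (simp add: sgn_scaleR)
    then show ?thesis using k'(1) by auto
  qed
  then show ?thesis by (auto simp: sphere_proj_body[OF V(1,2)] K K')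
qed

text \<open>Orthogonal projection onto a subspace containing \<open>u\<close> and \<open>y\<close>
  preserves inner products with both.\<close>

lemma slopes_sphere_proj:
  assumes M: "spherical_convex M" and nz: "\<And>m. m \<in> M \<Longrightarrow> u \<bullet> m \<noteq> 0"
  shows "slopes u y (sphere_proj M (span {u, y} \<inter> sphere 0 1)) = slopes u y M"
proof -
  have V: "subspace (span {u, y})" "u \<in> span {u, y}" "y \<in> span {u, y}" by (auto simp: span_base)
  have "sphere_proj M (span {u, y} \<inter> sphere 0 1) = sgn ` closest_point (span {u, y}) ` M"
    by (rule sphere_proj_eq_sgn_image[OF V(1,2) M]) (rule nz)
  then show ?thesis
    by (simp only: slopes_sgn_image) (simp add: slopes_def image_image inner_closest_point_subspace V)
qed

text \<open>Equal slopes mean equal projections to the great circle in the span of \<open>u\<close>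
  and \<open>y\<close>; by covariance the results have equal projections, hence equal
  slopes.\<close>

lemma projection_covariant_hemispheric:
  fixes f :: "'a::euclidean_space set \<Rightarrow> 'a set \<Rightarrow> 'a set"
  assumes dim: "3 \<le> DIM('a)" and cov: "projection_covariant f"
    and proper: "\<And>K L. (K, L) \<in> body_pairs \<Longrightarrow> f K L \<in> proper_bodies"
    and s: "\<bar>s\<bar> = 1"
    and pos: "\<And>u K L m. K \<in> bodies_in u \<Longrightarrow> L \<in> bodies_in u \<Longrightarrow> m \<in> f K L \<Longrightarrow> s * (u \<bullet> m) > 0"
  shows "hemispheric_operation (\<lambda>K L. (*\<^sub>R) s ` f K L)"
proof
  show "3 \<le> DIM('a)" by (rule dim)
next
  fix K L and u :: 'a
  assume K: "K \<in> bodies_in u" and L: "L \<in> bodies_in u"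
  have "convex_body (f K L)" using proper[OF body_pairsI[OF K L]] by (auto simp: proper_bodies_def)
  then show "(*\<^sub>R) s ` f K L \<in> bodies_in u"
    using pos[OF K L] s by (intro bodies_inI convex_body_scaleR_image) auto
next
  fix y u :: 'a and K K' L L'
  assume y: "y \<notin> span {u}" and K: "K \<in> bodies_in u" "K' \<in> bodies_in u" and L: "L \<in> bodies_in u" "L' \<in> bodies_in u"
    and eq: "slopes u y K = slopes u y K'" "slopes u y L = slopes u y L'"
  let ?V = "span {u, y}"
  let ?S = "?V \<inter> sphere 0 1"
  have u0: "u \<noteq> 0" using bodies_inD(1,6)[OF K(1)] by force
  have "u \<noteq> y" using y by (auto simp: span_base)
  moreover have "independent {y, u}" using u0 y by (simp add: independent_insert)
  ultimately have "dim {u, y} = 2" by (simp add: dim_eq_card_independent insert_commute)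
  then have "k_sphere 1 ?S" by (auto simp: k_sphere_def intro!: exI[of _ ?V])
  moreover have "sgn u \<in> ?S" using u0 by (simp add: norm_sgn sgn_div_norm span_base span_scale)
  \<comment> \<open>Great circles are the case \<open>k = 1\<close>, which the bound on
    \<open>k\<close> admits from dimension three on.\<close>
  ultimately have S: "1 + 2 \<le> DIM('a) \<and> k_sphere 1 ?S \<and> sgn u \<in> ?S" using dim by simp
  then have f: "f (sphere_proj M ?S) (sphere_proj N ?S) = sphere_proj (f M N) ?S"
    if "M \<in> bodies_in u" "N \<in> bodies_in u" for M N
    using cov that unfolding projection_covariant_def bodies_in_sgn[of u, symmetric] by blast
  have sl: "slopes u y ((*\<^sub>R) s ` f M N) = slopes u y (sphere_proj (f M N) ?S)"
    if "M \<in> bodies_in u" "N \<in> bodies_in u" for M N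
  proof -
    have "spherical_convex (f M N)"
      using proper[OF body_pairsI[OF that]] by (auto simp: proper_bodies_def convex_body_def)
    then have "slopes u y (sphere_proj (f M N) ?S) = slopes u y (f M N)"
      using pos[OF that] by (intro slopes_sphere_proj) force+
    moreover have "s \<noteq> 0" using s by auto
    ultimately show ?thesis by (simp add: slopes_scaleR_image)
  qed
  have "sphere_proj K ?S = sphere_proj K' ?S" "sphere_proj L ?S = sphere_proj L' ?S"
    using sphere_proj_mono_slopes K L eq by (metis equalityI order_refl)+
  then show "slopes u y ((*\<^sub>R) s ` f K L) = slopes u y ((*\<^sub>R) s ` f K' L')"
    using sl K L f by metis
qed

theorem theorem3:
  fixes n :: nat
    and f :: "(real ^ 'd) set \<Rightarrow> (real ^ 'd) set \<Rightarrow> (real ^ 'd) set"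
  assumes "n \<ge> 2"
    and "CARD('d) = n + 1"
    and "\<forall>(K, L) \<in> body_pairs. f K L \<in> proper_bodies"
  shows "(\<not> trivial_operation f \<and> projection_covariant f) \<longleftrightarrow>
    ((\<forall>(K, L) \<in> body_pairs. f K L = sconv (K \<union> L)) \<or>
     (\<forall>(K, L) \<in> body_pairs. f K L = uminus ` sconv (K \<union> L)))"
proof -
  have dim: "3 \<le> DIM(real ^ 'd)" using assms(1,2) by simp
  have one: "(*\<^sub>R) 1 ` M = M" and minus: "(*\<^sub>R) (-1) ` M = uminus ` M" for M :: "(real ^ 'd) set" by auto
  \<comment> \<open>A scalar of modulus one merges the two alternatives.\<close>
  have scaled: "((\<forall>(K, L) \<in> body_pairs. f K L = sconv (K \<union> L)) \<or>
     (\<forall>(K, L) \<in> body_pairs. f K L = uminus ` sconv (K \<union> L))) \<longleftrightarrow>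
     (\<exists>s. \<bar>s\<bar> = 1 \<and> (\<forall>(K, L) \<in> body_pairs. f K L = (*\<^sub>R) s ` sconv (K \<union> L)))" (is "_ \<longleftrightarrow> ?R")
  proof -
    have "\<bar>s\<bar> = 1 \<longleftrightarrow> s = 1 \<or> s = -1" for s :: real by auto
    then have ex: "(\<exists>s::real. \<bar>s\<bar> = 1 \<and> P s) \<longleftrightarrow> P 1 \<or> P (-1)" for P by metis
    show ?thesis unfolding ex one minus by (rule refl)
  qed
  show ?thesis
    unfolding scaled
  proof
    assume ?R
    then obtain s where "\<bar>s\<bar> = 1" "\<And>K L. (K, L) \<in> body_pairs \<Longrightarrow> f K L = (*\<^sub>R) s ` sconv (K \<union> L)" by blast
    then show "\<not> trivial_operation f \<and> projection_covariant f"
      using nontrivial_sconv[of s f] projection_covariant_sconv[of s f] dim by auto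
  next
    assume f: "\<not> trivial_operation f \<and> projection_covariant f"
    have proper: "f K L \<in> proper_bodies" if "(K, L) \<in> body_pairs" for K L
      using assms(3) that by blast
    have cov: "projection_covariant f" using f by simp
    obtain s :: real where s: "\<bar>s\<bar> = 1"
      and pos: "\<And>u K L m. K \<in> bodies_in u \<Longrightarrow> L \<in> bodies_in u \<Longrightarrow> m \<in> f K L \<Longrightarrow> s * (u \<bullet> m) > 0"
      by (rule global_sign[OF dim cov]) (erule proper, rule that)
    interpret hemispheric_operation "\<lambda>K L. (*\<^sub>R) s ` f K L"
      by (rule projection_covariant_hemispheric[OF dim cov proper s pos])
    have s1: "s = 1 \<or> s = -1" using s by auto
    \<comment> \<open>Scaling by \<open>s\<close> is an involution, so statements about the signed
      operation can be turned back into statements about \<open>f\<close>.\<close>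
    then have "s * s = 1" by auto
    then have "(*\<^sub>R) s ` (*\<^sub>R) s ` f K L = f K L" for K L by (simp add: image_image)
    then have inv: "f K L = (*\<^sub>R) s ` N" if "(*\<^sub>R) s ` f K L = N" for K L N
      using that by metis
    have lift: "\<forall>(K, L) \<in> body_pairs. f K L = (*\<^sub>R) s ` N K L"
      if N: "\<forall>u. \<forall>K \<in> bodies_in u. \<forall>L \<in> bodies_in u. (*\<^sub>R) s ` f K L = N K L" for N
    proof (clarify)
      fix K L :: "(real ^ 'd) set"
      assume "(K, L) \<in> body_pairs"
      then obtain u where "K \<in> bodies_in u" "L \<in> bodies_in u" by (rule body_pairsE)
      then have "(*\<^sub>R) s ` f K L = N K L" using N by blast
      then show "f K L = (*\<^sub>R) s ` N K L" by (rule inv)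
    qed
    from trichotomy show ?R
    proof (elim disjE)
      assume "\<forall>u. \<forall>K \<in> bodies_in u. \<forall>L \<in> bodies_in u. (*\<^sub>R) s ` f K L = K"
      then have "\<forall>(K, L) \<in> body_pairs. f K L = (*\<^sub>R) s ` K"
        by (rule lift[of "\<lambda>K L. K"])
      \<comment> \<open>For either value of \<open>s\<close> this is one of the excluded trivial
        operations.\<close>
      then have "trivial_operation f" using s1 unfolding trivial_operation_def
        by (elim disjE) (simp_all only: one minus, blast+)
      then show ?thesis using f by blast
    next
      assume "\<forall>u. \<forall>K \<in> bodies_in u. \<forall>L \<in> bodies_in u. (*\<^sub>R) s ` f K L = L"
      then have "\<forall>(K, L) \<in> body_pairs. f K L = (*\<^sub>R) s ` L"
        by (rule lift[of "\<lambda>K L. L"])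
      then have "trivial_operation f" using s1 unfolding trivial_operation_def
        by (elim disjE) (simp_all only: one minus, blast+)
      then show ?thesis using f by blast
    next
      assume "\<forall>u. \<forall>K \<in> bodies_in u. \<forall>L \<in> bodies_in u. (*\<^sub>R) s ` f K L = sconv (K \<union> L)"
      then have "\<forall>(K, L) \<in> body_pairs. f K L = (*\<^sub>R) s ` sconv (K \<union> L)"
        by (rule lift[of "\<lambda>K L. sconv (K \<union> L)"])
      then show ?thesis using s by blast
    qed
  qed
qed

end
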